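(* Let $n\ge 3$. The complex of trees $T_n$ and the reduced minimal nested set complex $\mathcal N(\Pi_n,\mathcal I)$ of the partition lattice $\Pi_n$ coincide as abstract simplicial complexes (i.e. they are isomorphic as abstract simplicial complexes).
   Context: **Trees.** A tree is a cycle-free (connected) graph; vertices of degree $1$ are its leaves. A rooted tree has one vertex of degree $>1$ marked as root. Internal vertices are the vertices other than the leaves and the root; they are assumed to have degree at least $3$. Equivalently, all non-leaves have outdegree at least $2$, where the outdegree of a vertex is the number of adjacent edges not lying on the path between the vertex and the root. A rooted tree is binary if all non-leaves have outdegree exactly $2$. An internal edge is an edge not adjacent to a leaf; a rooted binary tree on $n$ leaves has exactly $n-2$ internal edges. The combinatorial type of a rooted tree with labelled leaves is its equivalence class under label- and root-preserving homeomorphisms of trees as $1$-dimensional cell complexes. **Complex of trees.** For $n\ge 3$, $T_n$ is the abstract simplicial complex whose maximal simplices are the combinatorial types of binary rooted trees with $n$ leaves labelled $1,\dots,n$, and whose lower dimensional simplices are obtained by contracting at most $n-3$ internal edges. Thus vertices are the types of rooted trees with leaves labelled $1,\dots,n$ having exactly one internal edge, and a tree with $m\ge1$ internal edges is the $(m-1)$-simplex whose vertices are the $m$ trees obtained from it by contracting all but one of its internal edges; faces correspond to contracting internal edges. (The tree without internal edges corresponds to the empty simplex.) **Nested set complexes.** Let $\mathcal L$ be a finite lattice with minimum $\hat 0$ and maximum $\hat 1$. A subset $\mathcal G\subseteq\mathcal L_{>\hat 0}$ is a building set if for every $X\in\mathcal L_{>\hat 0}$, writing $\max \mathcal G_{\le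 X}=\{G_1,\dots,G_k\}$ for the set of maximal elements of $\{G\in\mathcal G: G\le X\}$, there is a poset isomorphism $\varphi_X:\prod_{j=1}^k[\hat 0,G_j]\to[\hat 0,X]$ with $\varphi_X(\hat 0,\dots,G_j,\dots,\hat 0)=G_j$ for all $j$. The minimal building set $\mathcal I$ consists of the irreducible elements of $\mathcal L$: those $X\in\mathcal L_{>\hat 0}$ for which $[\hat 0,X]$ has no (nontrivial) product decomposition. For a building set $\mathcal G$ containing $\hat 1$, a subset $\mathcal S\subseteq\mathcal G$ is nested if for any set of at least two pairwise incomparable elements $X_1,\dots,X_t\in\mathcal S$ the join $X_1\vee\dots\vee X_t$ is not in $\mathcal G$. The nested sets form an abstract simplicial complex $\widetilde{\mathcal N}(\mathcal L,\mathcal G)$, a cone with apex $\hat 1$; its base, consisting of the nested sets not containing $\hat 1$, is the reduced nested set complex $\mathcal N(\mathcal L,\mathcal G)$. **Partition lattice.** $\Pi_n$ is the lattice of set partitions of $[n]=\{1,\dots,n\}$, ordered by reversed refinement, so that $\hat 0$ is the partition into singletons and $\hat 1$ is the partition with one block. Its irreducible elements are the partitions with exactly one non-singleton block. *)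

theory Defs
  imports
    "HOL-Analysis.Analysis"
    "HOL-Algebra.Lattice"
    "HOL-Library.Disjoint_Sets"
begin

section \<open>Abstract simplicial complexes\<close>

text \<open>A complex is its set of simplices, the empty simplex included; the vertex set of \<open>K\<close>
  is \<open>\<Union>K\<close>.\<close>

definition abstract_simplicial_complex :: "'a set set \<Rightarrow> bool" where
  "abstract_simplicial_complex K \<longleftrightarrow>
     {} \<in> K \<and> (\<forall>\<sigma>\<in>K. finite \<sigma> \<and> (\<forall>\<tau>. \<tau> \<subseteq> \<sigma> \<longrightarrow> \<tau> \<in> K))"

definition isomorphic_complexes :: "'a set set \<Rightarrow> 'b set set \<Rightarrow> bool" where
  "isomorphic_complexes K L \<longleftrightarrow>
     abstract_simplicial_complex K \<and> abstract_simplicial_complex L \<and>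
     (\<exists>f. bij_betw f (\<Union>K) (\<Union>L) \<and> (\<forall>\<sigma>. \<sigma> \<subseteq> \<Union>K \<longrightarrow> (\<sigma> \<in> K \<longleftrightarrow> f ` \<sigma> \<in> L)))"


section \<open>Trees\<close>

definition gpath :: "'v set \<Rightarrow> 'v set set \<Rightarrow> 'v list \<Rightarrow> bool" where
  "gpath V E p \<longleftrightarrow>
     p \<noteq> [] \<and> set p \<subseteq> V \<and> distinct p \<and> successively (\<lambda>u v. {u, v} \<in> E) p"

definition gpath_edges :: "'v list \<Rightarrow> 'v set set" where
  "gpath_edges p = {{p ! i, p ! Suc i} | i. Suc i < length p}"

definition gcycle :: "'v set \<Rightarrow> 'v set set \<Rightarrow> 'v list \<Rightarrow> bool" where
  "gcycle V E p \<longleftrightarrow> gpath V E p \<and> 3 \<le> length p \<and> {last p, hd p} \<in> E"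

definition is_graph :: "'v set \<Rightarrow> 'v set set \<Rightarrow> bool" where
  "is_graph V E \<longleftrightarrow> finite V \<and> (\<forall>e\<in>E. e \<subseteq> V \<and> card e = 2)"

definition is_tree :: "'v set \<Rightarrow> 'v set set \<Rightarrow> bool" where
  "is_tree V E \<longleftrightarrow>
     is_graph V E \<and> V \<noteq> {} \<and>
     (\<forall>u\<in>V. \<forall>v\<in>V. \<exists>p. gpath V E p \<and> hd p = u \<and> last p = v) \<and>
     (\<nexists>p. gcycle V E p)"

text \<open>\<open>leaf T i\<close> is the leaf labelled \<open>i\<close>; it is meaningful only for labels \<open>i\<close> in \<open>{1..n}\<close>.\<close>

record 'v ltree =
  vertices :: "'v set"
  edges :: "'v set set"
  root_vertex :: 'v
  leaf :: "nat \<Rightarrow> 'v"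

definition degree_in :: "'v ltree \<Rightarrow> 'v \<Rightarrow> nat" where
  "degree_in T v = card {e \<in> edges T. v \<in> e}"

definition leaves :: "'v ltree \<Rightarrow> 'v set" where
  "leaves T = {v \<in> vertices T. degree_in T v = 1}"

definition rooted_tree :: "nat \<Rightarrow> 'v ltree \<Rightarrow> bool" where
  "rooted_tree n T \<longleftrightarrow>
     is_tree (vertices T) (edges T) \<and>
     root_vertex T \<in> vertices T \<and> 1 < degree_in T (root_vertex T) \<and>
     (\<forall>v \<in> vertices T - leaves T - {root_vertex T}. 3 \<le> degree_in T v) \<and>
     bij_betw (leaf T) {1..n} (leaves T)"

definition outdegree :: "'v ltree \<Rightarrow> 'v \<Rightarrow> nat" where
  "outdegree T v = card {e \<in> edges T. v \<in> e \<and>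
     \<not> (\<exists>p. gpath (vertices T) (edges T) p \<and> hd p = v \<and> last p = root_vertex T \<and>
            e \<in> gpath_edges p)}"

definition binary_tree :: "nat \<Rightarrow> 'v ltree \<Rightarrow> bool" where
  "binary_tree n T \<longleftrightarrow>
     rooted_tree n T \<and> (\<forall>v \<in> vertices T - leaves T. outdegree T v = 2)"

definition internal_edges :: "'v ltree \<Rightarrow> 'v set set" where
  "internal_edges T = {e \<in> edges T. e \<inter> leaves T = {}}"


subsection \<open>Combinatorial types\<close>

text \<open>The geometric realization of a tree in barycentric coordinates: the closed 1-cell of an
  edge \<open>e\<close> consists of the convex combinations of its two end points. The ambient space carries
  the product topology. Every vertex of a rooted tree lies on an edge, so that taking the union
  over all edges suffices.\<close>

definition realization :: "'v ltree \<Rightarrow> ('v \<Rightarrow> real) set" where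
  "realization T = {x. \<exists>e\<in>edges T.
     (\<forall>v. 0 \<le> x v) \<and> (\<forall>v. v \<notin> e \<longrightarrow> x v = 0) \<and> (\<Sum>v\<in>e. x v) = 1}"

definition vertex_point :: "'v \<Rightarrow> 'v \<Rightarrow> real" where
  "vertex_point v = indicator {v}"

text \<open>In a rooted tree only the root can have degree 2, so a homeomorphism that preserves the
  root and the leaf labels maps vertices to vertices and edges to edges.\<close>

definition same_type :: "nat \<Rightarrow> 'v ltree \<Rightarrow> 'w ltree \<Rightarrow> bool" where
  "same_type n T T' \<longleftrightarrow>
     (\<exists>h k. homeomorphism (realization T) (realization T') h k \<and>
        h (vertex_point (root_vertex T)) = vertex_point (root_vertex T') \<and>
        (\<forall>i\<in>{1..n}. h (vertex_point (leaf T i)) = vertex_point (leaf T' i)))"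

text \<open>Every finite tree has a copy on vertices in \<open>nat\<close>, so restricting the members of an
  equivalence class to such trees identifies no two types and loses none.\<close>

definition combinatorial_type :: "nat \<Rightarrow> 'v ltree \<Rightarrow> nat ltree set" where
  "combinatorial_type n T = {T'. rooted_tree n T' \<and> same_type n T T'}"


subsection \<open>The complex of trees\<close>

text \<open>Contraction of a set \<open>F\<close> of edges: the new vertices are the connected components of the
  graph with edge set \<open>F\<close>.\<close>

definition component_of :: "'v set set \<Rightarrow> 'v \<Rightarrow> 'v set" where
  "component_of F v = {(x, y). {x, y} \<in> F}\<^sup>* `` {v}"

definition contract :: "'v ltree \<Rightarrow> 'v set set \<Rightarrow> 'v set ltree" where
  "contract T F =
     \<lparr>vertices = component_of F ` vertices T,
      edges = (\<lambda>e. component_of F ` e) ` (edges T - F),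
      root_vertex = component_of F (root_vertex T),
      leaf = (\<lambda>i. component_of F (leaf T i))\<rparr>"

text \<open>The simplex given by a tree with \<open>m\<close> internal edges: its vertices are the types of
  the \<open>m\<close> trees obtained by contracting all but one of the internal edges.\<close>

definition tree_simplex :: "nat \<Rightarrow> 'v ltree \<Rightarrow> nat ltree set set" where
  "tree_simplex n T =
     {combinatorial_type n (contract T (internal_edges T - {e})) | e. e \<in> internal_edges T}"

definition complex_of_trees :: "nat \<Rightarrow> nat ltree set set set" where
  "complex_of_trees n =
     insert {} {tree_simplex n (contract T F) | (T :: nat ltree) F.
       binary_tree n T \<and> F \<subseteq> internal_edges T \<and> card F \<le> n - 3}"


section \<open>Nested set complexes\<close>

definition order_isomorphism :: "'a gorder \<Rightarrow> 'b gorder \<Rightarrow> ('a \<Rightarrow> 'b) \<Rightarrow> bool" where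
  "order_isomorphism P Q \<phi> \<longleftrightarrow> order_emb P Q \<phi> \<and> bij_betw \<phi> (carrier P) (carrier Q)"

definition product_order :: "'a gorder \<Rightarrow> 'b gorder \<Rightarrow> ('a \<times> 'b) gorder" where
  "product_order P Q =
     \<lparr>carrier = carrier P \<times> carrier Q,
      eq = (=),
      le = (\<lambda>x y. fst x \<sqsubseteq>\<^bsub>P\<^esub> fst y \<and> snd x \<sqsubseteq>\<^bsub>Q\<^esub> snd y)\<rparr>"

definition lower_interval :: "'a gorder \<Rightarrow> 'a \<Rightarrow> 'a gorder" where
  "lower_interval L X = L\<lparr>carrier := \<lbrace>\<bottom>\<^bsub>L\<^esub>..X\<rbrace>\<^bsub>L\<^esub>\<rparr>"

text \<open>The factors range over posets on the element type of \<open>L\<close>; this is no restriction, since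
  each factor of an interval is isomorphic to a subset of it. A product decomposition is
  nontrivial if both factors have more than one element.\<close>

definition decomposable :: "'a gorder \<Rightarrow> 'a \<Rightarrow> bool" where
  "decomposable L X \<longleftrightarrow>
     (\<exists>(P :: 'a gorder) (Q :: 'a gorder) \<phi>.
        partial_order P \<and> partial_order Q \<and>
        1 < card (carrier P) \<and> 1 < card (carrier Q) \<and>
        order_isomorphism (product_order P Q) (lower_interval L X) \<phi>)"

text \<open>The minimal building set.\<close>

definition irreducible_elements :: "'a gorder \<Rightarrow> 'a set" where
  "irreducible_elements L = {X \<in> carrier L - {\<bottom>\<^bsub>L\<^esub>}. \<not> decomposable L X}"

text \<open>The nested set complex makes sense for any set \<open>G\<close> of lattice elements; it is used for
  building sets that contain the maximum of the lattice.\<close>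

definition nested :: "'a gorder \<Rightarrow> 'a set \<Rightarrow> 'a set \<Rightarrow> bool" where
  "nested L G S \<longleftrightarrow>
     S \<subseteq> G \<and>
     (\<forall>A. A \<subseteq> S \<and> finite A \<and> 2 \<le> card A \<and>
          (\<forall>x\<in>A. \<forall>y\<in>A. x \<noteq> y \<longrightarrow> \<not> x \<sqsubseteq>\<^bsub>L\<^esub> y \<and> \<not> y \<sqsubseteq>\<^bsub>L\<^esub> x)
        \<longrightarrow> \<Squnion>\<^bsub>L\<^esub> A \<notin> G)"

definition nested_set_complex :: "'a gorder \<Rightarrow> 'a set \<Rightarrow> 'a set set" where
  "nested_set_complex L G = {S. nested L G S}"

definition reduced_nested_set_complex :: "'a gorder \<Rightarrow> 'a set \<Rightarrow> 'a set set" where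
  "reduced_nested_set_complex L G = {S \<in> nested_set_complex L G. \<top>\<^bsub>L\<^esub> \<notin> S}"


section \<open>The partition lattice\<close>

text \<open>Finer partitions are smaller: the minimum is the partition into singletons.\<close>

definition partition_lattice :: "nat \<Rightarrow> nat set set gorder" where
  "partition_lattice n =
     \<lparr>carrier = {P. partition_on {1..n} P},
      eq = (=),
      le = refines {1..n}\<rparr>"

end

theory Submission
  imports Defs
begin

text \<open>
  Label each vertex \<open>v\<close> of a rooted tree by its cluster, the set of labels of the leaves below \<open>v\<close>.
  The clusters of a tree form a hierarchy: a laminar family (any two members are nested or
  disjoint) that contains \<open>{1..n}\<close> and all singletons. Since every vertex other than a leaf has at
  least two children, different vertices have different clusters, and the edges are the covering
  pairs of the hierarchy. Contracting an internal edge deletes the cluster of its lower end and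
  leaves the others alone. So a simplex of the complex of trees is a laminar family of
  proper clusters, that is of subsets \<open>C\<close> of \<open>{1..n}\<close> with \<open>2 \<le> |C| < n\<close>; its vertices are the types
  of the trees with a single proper cluster.

  On the side of the partition lattice, the irreducible elements are the partitions with exactly
  one block \<open>C\<close> of size at least 2. The join of two of them with
  overlapping blocks is again of this form, with the union as its block, whereas the join of
  partitions with pairwise disjoint blocks has all these blocks and so is reducible. Hence a set of
  irreducible elements is nested iff its blocks form a laminar family, and leaving out the top of
  the lattice means leaving out the block \<open>{1..n}\<close>. Both complexes are therefore images of the
  complex of laminar families of proper clusters under maps that are injective on vertices.

  Three steps need real work. First, the clusters have to be invariants of
  combinatorial types, which are defined by homeomorphisms. The cluster of \<open>v\<close> consists of the labels
  of the leaves that the point \<open>v\<close> cuts off from the root, and each point inside an edge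
  cuts off the same leaves as the lower end of the edge; so the family of all sets of labels cut off by
  points of the realization is the hierarchy (\<open>separated_image\<close>), and it is visibly a topological
  invariant. Conversely a bijection of vertices that respects clusters extends linearly to a
  homeomorphism. This gives \<open>same_type_iff\<close>. Second, each laminar family has to come from a binary
  tree by contracting at most \<open>n - 3\<close> edges. A maximal laminar family of proper clusters is
  binary, for otherwise the union of two siblings could be added (\<open>binary_refinement\<close>), and a
  hierarchy has at most \<open>n - 2\<close> proper clusters (\<open>hierarchy_card_le\<close>). Third, a partition with one big
  block must be irreducible (\<open>one_block_not_decomposable\<close>); this comes down to the fact
  that a complete graph is not the union of two disjoint unions of smaller complete graphs.
\<close>

section \<open>Laminar families and hierarchies\<close>

definition laminar :: "'a set set \<Rightarrow> bool" where
  "laminar H \<longleftrightarrow> (\<forall>A\<in>H. \<forall>B\<in>H. A \<subseteq> B \<or> B \<subseteq> A \<or> A \<inter> B = {})"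

definition trivial_clusters :: "nat \<Rightarrow> nat set set" where
  "trivial_clusters n = insert {1..n} ((\<lambda>i. {i}) ` {1..n})"

definition proper_clusters :: "nat \<Rightarrow> nat set set" where
  "proper_clusters n = {C. C \<subseteq> {1..n} \<and> C \<noteq> {1..n} \<and> 2 \<le> card C}"

definition hierarchy :: "nat \<Rightarrow> nat set set \<Rightarrow> bool" where
  "hierarchy n H \<longleftrightarrow>
     2 \<le> n \<and> H \<subseteq> Pow {1..n} \<and> {} \<notin> H \<and> trivial_clusters n \<subseteq> H \<and> laminar H"

text \<open>In a laminar family the proper supersets of a member form a chain, so the covering relation
  of inclusion may be stated by asking for the least proper superset.\<close>

definition covers :: "'a set set \<Rightarrow> 'a set \<Rightarrow> 'a set \<Rightarrow> bool" where
  "covers H A B \<longleftrightarrow> A \<in> H \<and> B \<in> H \<and> A \<subset> B \<and> (\<forall>C\<in>H. A \<subset> C \<longrightarrow> B \<subseteq> C)"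

lemma laminarD: "laminar H \<Longrightarrow> A \<in> H \<Longrightarrow> B \<in> H \<Longrightarrow> x \<in> A \<Longrightarrow> x \<in> B \<Longrightarrow> A \<subseteq> B \<or> B \<subseteq> A"
  unfolding laminar_def by blast

lemma laminar_subset: "laminar H \<Longrightarrow> G \<subseteq> H \<Longrightarrow> laminar G"
  unfolding laminar_def by blast

lemma laminar_insert:
  "laminar (insert D H) \<longleftrightarrow> laminar H \<and> (\<forall>X\<in>H. X \<subseteq> D \<or> D \<subseteq> X \<or> X \<inter> D = {})"
  unfolding laminar_def by (simp add: ball_conj_distrib Int_commute) blast

lemma coversD:
  assumes "covers H A B"
  shows "A \<in> H" "B \<in> H" "A \<subset> B" "C \<in> H \<Longrightarrow> A \<subset> C \<Longrightarrow> B \<subseteq> C"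
  using assms unfolding covers_def by blast+

lemma covers_unique: "covers H A B \<Longrightarrow> covers H A C \<Longrightarrow> B = C"
  unfolding covers_def by blast

lemma hierarchy_finite: "hierarchy n H \<Longrightarrow> finite H"
  unfolding hierarchy_def using finite_subset[of H "Pow {1..n}"] by auto

lemma hierarchy_top: "hierarchy n H \<Longrightarrow> {1..n} \<in> H"
  unfolding hierarchy_def trivial_clusters_def by auto

lemma hierarchy_singleton: "hierarchy n H \<Longrightarrow> i \<in> {1..n} \<Longrightarrow> {i} \<in> H"
  unfolding hierarchy_def trivial_clusters_def by auto

lemma hierarchy_mem:
  assumes "hierarchy n H" "A \<in> H"
  shows "A \<subseteq> {1..n}" "A \<noteq> {}" "finite A"
  using assms finite_subset[of A "{1..n}"] unfolding hierarchy_def by auto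

lemma hierarchy_laminar: "hierarchy n H \<Longrightarrow> laminar H"
  unfolding hierarchy_def by auto

lemma hierarchy_nested:
  "hierarchy n H \<Longrightarrow> A \<in> H \<Longrightarrow> B \<in> H \<Longrightarrow> x \<in> A \<Longrightarrow> x \<in> B \<Longrightarrow> A \<subseteq> B \<or> B \<subseteq> A"
  using hierarchy_laminar laminarD by metis

lemma hierarchy_cases:
  assumes "hierarchy n H" "A \<in> H"
  obtains "A = {1..n}" | i where "i \<in> {1..n}" "A = {i}" | "A \<in> proper_clusters n"
proof -
  have A: "A \<subseteq> {1..n}" "A \<noteq> {}" "finite A" using hierarchy_mem[OF assms] by auto
  show ?thesis
  proof (cases "2 \<le> card A")
    case True
    then show ?thesis using A that unfolding proper_clusters_def by blast
  next
    case False
    moreover have "card A \<noteq> 0" using A by simp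
    ultimately have "card A = 1" by linarith
    then obtain i where "A = {i}" by (auto simp: card_1_singleton_iff)
    then show ?thesis using A that by auto
  qed
qed

lemma hierarchy_split:
  assumes "hierarchy n H"
  shows "H = trivial_clusters n \<union> (H \<inter> proper_clusters n)"
proof
  show "H \<subseteq> trivial_clusters n \<union> (H \<inter> proper_clusters n)"
  proof
    fix A assume "A \<in> H"
    then show "A \<in> trivial_clusters n \<union> (H \<inter> proper_clusters n)"
      by (rule hierarchy_cases[OF assms]) (use \<open>A \<in> H\<close> in \<open>auto simp: trivial_clusters_def\<close>)
  qed
  show "trivial_clusters n \<union> (H \<inter> proper_clusters n) \<subseteq> H"
    using assms unfolding hierarchy_def by auto
qed

lemma trivial_proper_disjoint: "trivial_clusters n \<inter> proper_clusters n = {}"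
  unfolding trivial_clusters_def proper_clusters_def by auto

lemma hierarchy_of_laminar:
  assumes "2 \<le> n" "N \<subseteq> proper_clusters n" "laminar N"
  shows "hierarchy n (trivial_clusters n \<union> N)"
proof -
  have "laminar (trivial_clusters n \<union> N)"
    unfolding laminar_def
  proof (intro ballI)
    fix A B assume *: "A \<in> trivial_clusters n \<union> N" "B \<in> trivial_clusters n \<union> N"
    have "A \<subseteq> {1..n}" "B \<subseteq> {1..n}"
      using * assms(2) unfolding trivial_clusters_def proper_clusters_def by auto
    moreover have "A \<in> N \<or> A = {1..n} \<or> (\<exists>i. A = {i})" "B \<in> N \<or> B = {1..n} \<or> (\<exists>i. B = {i})"
      using * unfolding trivial_clusters_def by auto
    ultimately show "A \<subseteq> B \<or> B \<subseteq> A \<or> A \<inter> B = {}"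
      using assms(3) unfolding laminar_def by blast
  qed
  then show ?thesis
    using assms unfolding hierarchy_def trivial_clusters_def proper_clusters_def by auto
qed

lemma covers_exists:
  assumes H: "hierarchy n H" and A: "A \<in> H" "A \<noteq> {1..n}"
  shows "\<exists>B. covers H A B"
proof -
  let ?U = "{C \<in> H. A \<subset> C}"
  have "finite ?U" "{1..n} \<in> ?U"
    using hierarchy_finite[OF H] hierarchy_top[OF H] hierarchy_mem[OF H A(1)] A by auto
  from finite_has_minimal2[OF this]
  obtain B where B: "B \<in> ?U" "\<forall>C\<in>?U. C \<subseteq> B \<longrightarrow> B = C" by (elim bexE conjE)
  obtain x where x: "x \<in> A" using hierarchy_mem[OF H A(1)] by blast
  have "B \<subseteq> C" if "C \<in> H" "A \<subset> C" for C
    using hierarchy_nested[OF H, of B C x] B that x by blast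
  then show ?thesis using B A unfolding covers_def by blast
qed

lemma child_containing:
  assumes H: "hierarchy n H" and A: "A \<in> H" "A \<noteq> {x}" "x \<in> A"
  shows "\<exists>B. covers H B A \<and> x \<in> B"
proof -
  let ?U = "{C \<in> H. C \<subset> A \<and> x \<in> C}"
  have "finite ?U" "{x} \<in> ?U"
    using hierarchy_finite[OF H] hierarchy_singleton[OF H, of x] hierarchy_mem[OF H A(1)] A by auto
  from finite_has_maximal2[OF this]
  obtain B where B: "B \<in> ?U" "\<forall>C\<in>?U. B \<subseteq> C \<longrightarrow> B = C" by (elim bexE conjE)
  have "A \<subseteq> C" if "C \<in> H" "B \<subset> C" for C
  proof -
    have "x \<in> C" using B(1) that by blast
    then have "A \<subseteq> C \<or> C \<subset> A" using hierarchy_nested[OF H, of A C x] that A by blast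
    moreover have "\<not> C \<subset> A" using B \<open>x \<in> C\<close> that by blast
    ultimately show ?thesis by blast
  qed
  then show ?thesis using B A unfolding covers_def by blast
qed

lemma children_disjoint:
  assumes H: "hierarchy n H" and "covers H B A" "covers H C A" "B \<noteq> C"
  shows "B \<inter> C = {}"
proof (rule ccontr)
  assume "B \<inter> C \<noteq> {}"
  then obtain x where "x \<in> B" "x \<in> C" by blast
  then have "B \<subset> C \<or> C \<subset> B"
    using hierarchy_nested[OF H coversD(1)[OF assms(2)] coversD(1)[OF assms(3)]] assms(4) by blast
  then show False
    using coversD(3)[OF assms(3)] coversD(3)[OF assms(2)]
      coversD(4)[OF assms(2), of C] coversD(4)[OF assms(3), of B] coversD(1)[OF assms(2)]
      coversD(1)[OF assms(3)] by blast
qed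

text \<open>The children of a cluster \<open>A\<close> partition it: each point lies in a child, because
  singletons are clusters. A child is a proper subset, so there must be a second one. Both children are
  located relative to a given \<open>x\<close> because the counting argument below takes \<open>x = Min A\<close>.\<close>

lemma two_children:
  assumes H: "hierarchy n H" and A: "A \<in> H" "\<not> is_singleton A" "x \<in> A"
  obtains B C where "covers H B A" "covers H C A" "B \<noteq> C" "x \<in> B" "x \<notin> C"
proof -
  have "A \<noteq> {x}" using A(2) by auto
  then obtain B where B: "covers H B A" "x \<in> B" using child_containing[OF H A(1)] A(3) by blast
  then obtain y where y: "y \<in> A" "y \<notin> B" using coversD(3) by blast
  have "A \<noteq> {y}" using A(2) by auto
  then obtain C where C: "covers H C A" "y \<in> C" using child_containing[OF H A(1)] y by blast
  then show ?thesis using that[of B C] B y children_disjoint[OF H B(1) C(1)] by blast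
qed

text \<open>Send a cluster \<open>A\<close> with at least two elements to the minimum \<open>i\<close> of a child that does not
  contain \<open>Min A\<close>. That child is the largest cluster with minimum \<open>i\<close>, and \<open>A\<close> is the cluster that covers
  it, so this map is injective. Its values lie in \<open>{2..n}\<close>; one of the at most \<open>n - 1\<close> arguments is
  \<open>{1..n}\<close>.\<close>

lemma hierarchy_card_le:
  assumes H: "hierarchy n H"
  shows "card (H \<inter> proper_clusters n) \<le> n - 2"
proof -
  \<comment> \<open>besides the proper clusters, this includes \<open>{1..n}\<close>, which is subtracted at the end\<close>
  let ?N = "{A \<in> H. \<not> is_singleton A}"
  have ex: "\<exists>B. covers H B A \<and> Min A \<notin> B" if "A \<in> ?N" for A
  proof -
    have A: "A \<in> H" "\<not> is_singleton A" using that by auto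
    have "Min A \<in> A" using hierarchy_mem[OF H A(1)] by simp
    from two_children[OF H A this] show ?thesis by metis
  qed
  define child where "child A = (SOME B. covers H B A \<and> Min A \<notin> B)" for A
  have child: "covers H (child A) A" "Min A \<notin> child A" if "A \<in> ?N" for A
    using someI_ex[OF ex[OF that]] unfolding child_def by auto
  have fin: "finite (child A)" "child A \<noteq> {}" "child A \<subset> A" "finite A" if "A \<in> ?N" for A
    using coversD[OF child(1)[OF that]] hierarchy_mem[OF H, of A] hierarchy_mem[OF H, of "child A"]
    by blast+
  have lt: "Min A < Min (child A)" if "A \<in> ?N" for A
  proof -
    have "Min (child A) \<in> child A" using fin[OF that] by simp
    moreover from this have "Min A \<le> Min (child A)" using fin(3,4)[OF that] by (intro Min_le) auto
    ultimately show ?thesis using child(2)[OF that] by (metis nat_less_le)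
  qed
  have key: "child A = child B" if "A \<in> ?N" "B \<in> ?N" "Min (child A) = Min (child B)" "child A \<subseteq> child B" for A B
  proof (rule ccontr)
    assume "child A \<noteq> child B"
    then have "A \<subseteq> child B" using child(1)[OF that(1)] child(1)[OF that(2)] that(4)
      coversD(1)[OF child(1)[OF that(2)]] coversD(4)[OF child(1)[OF that(1)], of "child B"] by blast
    moreover have "Min A \<in> A" using fin(3,4)[OF that(1)] by (intro Min_in) auto
    ultimately have "Min A \<in> child B" by blast
    then have "Min (child B) \<le> Min A" using fin[OF that(2)] by simp
    then show False using lt[OF that(1)] that(3) by simp
  qed
  have "inj_on (\<lambda>A. Min (child A)) ?N"
  proof (rule inj_onI)
    fix A B assume *: "A \<in> ?N" "B \<in> ?N" "Min (child A) = Min (child B)"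
    have "Min (child A) \<in> child A" "Min (child A) \<in> child B"
      using Min_in[OF fin(1,2)[OF *(1)]] Min_in[OF fin(1,2)[OF *(2)]] *(3) by auto
    then have "child A \<subseteq> child B \<or> child B \<subseteq> child A"
      using hierarchy_nested[OF H coversD(1)[OF child(1)[OF *(1)]] coversD(1)[OF child(1)[OF *(2)]]]
      by blast
    then have "child A = child B" 
      using key[OF *] key[OF *(2,1) *(3)[symmetric]] by blast
    then have "covers H (child A) B" using child(1)[OF *(2)] by simp
    then show "A = B" by (rule covers_unique[OF child(1)[OF *(1)]])
  qed
  moreover have "(\<lambda>A. Min (child A)) ` ?N \<subseteq> {2..n}"
  proof
    fix i assume "i \<in> (\<lambda>A. Min (child A)) ` ?N"
    then obtain A where A: "A \<in> ?N" "i = Min (child A)" by blast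
    have "child A \<noteq> {}" "finite (child A)" "child A \<subset> A" "finite A" "A \<noteq> {}" using fin[OF A(1)] by auto
    then have "Min A \<in> A" "Min (child A) \<in> A" using Min_in[of A] Min_in[of "child A"] by blast+
    then have "Min A \<ge> 1" "Min (child A) \<le> n" using hierarchy_mem[OF H, of A] A by auto
    then show "i \<in> {2..n}" using lt[OF A(1)] A(2) by auto
  qed
  ultimately have "card ?N \<le> card {2..n}" by (metis card_inj_on_le finite_atLeastAtMost)
  then have 1: "card ?N \<le> n - 1" by simp
  have "insert {1..n} (H \<inter> proper_clusters n) \<subseteq> ?N"
  proof -
    have "\<not> is_singleton {1..n}" using H unfolding hierarchy_def is_singleton_altdef by auto
    then show ?thesis using hierarchy_top[OF H]
      by (auto simp: proper_clusters_def is_singleton_altdef)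
  qed
  then have "card (insert {1..n} (H \<inter> proper_clusters n)) \<le> card ?N"
    using hierarchy_finite[OF H] by (intro card_mono) auto
  moreover have "card (insert {1..n} (H \<inter> proper_clusters n)) = Suc (card (H \<inter> proper_clusters n))"
    using hierarchy_finite[OF H] by (intro card_insert_disjoint) (auto simp: proper_clusters_def)
  ultimately show ?thesis using 1 H by (auto simp: hierarchy_def)
qed

definition binary_hierarchy :: "'a set set \<Rightarrow> bool" where
  "binary_hierarchy H \<longleftrightarrow> (\<forall>A\<in>H. \<not> is_singleton A \<longrightarrow> card {B. covers H B A} = 2)"

text \<open>In a maximal laminar family no cluster has three children: the union of two of them is a
  proper cluster that is compatible with all others, and it is not a member, as it lies strictly
  between a child and its parent.\<close>

lemma binary_refinement:
  assumes "2 \<le> n" "N \<subseteq> proper_clusters n" "laminar N"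
  obtains H where "hierarchy n H" "N \<subseteq> H" "binary_hierarchy H"
proof -
  let ?U = "{M. N \<subseteq> M \<and> M \<subseteq> proper_clusters n \<and> laminar M}"
  have "proper_clusters n \<subseteq> Pow {1..n}" unfolding proper_clusters_def by auto
  then have "?U \<subseteq> Pow (Pow {1..n})" by blast
  then have fin: "finite ?U" by (rule finite_subset) simp
  have "N \<in> ?U" using assms by simp
  from finite_has_maximal2[OF fin this]
  obtain M where M: "M \<in> ?U" "\<forall>M'\<in>?U. M \<subseteq> M' \<longrightarrow> M = M'" by (elim bexE conjE)
  define H where "H = trivial_clusters n \<union> M"
  have H: "hierarchy n H" unfolding H_def using hierarchy_of_laminar assms(1) M(1) by blast
  have "card {B. covers H B A} = 2" if A: "A \<in> H" "\<not> is_singleton A" for A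
  proof -
    obtain x where "x \<in> A" using hierarchy_mem[OF H A(1)] by blast
    obtain B C where BC: "covers H B A" "covers H C A" "B \<noteq> C"
      using two_children[OF H A \<open>x \<in> A\<close>] by metis
    have mem: "B \<in> H" "C \<in> H" by (fact coversD(1)[OF BC(1)] coversD(1)[OF BC(2)])+
    have ne: "B \<noteq> {}" "C \<noteq> {}" "B \<inter> C = {}" "finite B" "finite C"
      by (fact hierarchy_mem[OF H mem(1)] hierarchy_mem[OF H mem(2)] children_disjoint[OF H BC])+
    have "E = B \<or> E = C" if E: "covers H E A" for E
    proof (rule ccontr)
      assume neq: "\<not> ?thesis"
      have "E \<in> H" using E by (rule coversD)
      then have E': "E \<noteq> {}" "E \<inter> B = {}" "E \<inter> C = {}"
        using children_disjoint[OF H E BC(1)] children_disjoint[OF H E BC(2)] neq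
          hierarchy_mem(2)[OF H \<open>E \<in> H\<close>] by blast+
      let ?D = "B \<union> C"
      have sub: "B \<subset> A" "C \<subset> A" "E \<subset> A" "A \<subseteq> {1..n}"
        by (fact coversD(3)[OF BC(1)] coversD(3)[OF BC(2)] coversD(3)[OF E] hierarchy_mem(1)[OF H A(1)])+
      have "?D \<notin> H"
      proof
        assume "?D \<in> H"
        moreover have "B \<subset> ?D" using ne by blast
        ultimately have "A \<subseteq> ?D" by (rule coversD(4)[OF BC(1)])
        then show False using E' sub by blast
      qed
      moreover have "?D \<in> proper_clusters n"
      proof -
        have "card ?D = card B + card C" using ne by (simp add: card_Un_disjoint)
        moreover have "card B \<noteq> 0" "card C \<noteq> 0" using ne by auto
        ultimately have "2 \<le> card ?D" by linarith
        then show ?thesis using sub E' unfolding proper_clusters_def by blast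
      qed
      moreover have "X \<subseteq> ?D \<or> ?D \<subseteq> X \<or> X \<inter> ?D = {}" if X: "X \<in> H" for X
      proof -
        consider "X \<inter> A = {}" | "A \<subseteq> X" | "X \<subset> A"
          using hierarchy_laminar[OF H] X A(1) unfolding laminar_def by blast
        then show ?thesis
        proof cases
          case 3
          have "X \<subseteq> Y \<or> X \<inter> Y = {}" if "covers H Y A" for Y
          proof -
            have "\<not> Y \<subset> X" using coversD(4)[OF that X] 3 by blast
            then show ?thesis using hierarchy_nested[OF H X coversD(1)[OF that]] by blast
          qed
          then show ?thesis using BC by blast
        qed (use sub in blast)+
      qed
      ultimately have "insert ?D M \<in> ?U" "?D \<notin> M"
        using M(1) by (auto simp: laminar_insert H_def)
      then have "M = insert ?D M" using bspec[OF M(2), of "insert ?D M"] by (simp add: subset_insertI)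
      then show False using \<open>?D \<notin> M\<close> by (metis insertI1)
    qed
    then have "{B. covers H B A} = {B, C}" using BC(1,2) by auto
    then show ?thesis using BC(3) by simp
  qed
  then have "binary_hierarchy H" unfolding binary_hierarchy_def by simp
  moreover have "N \<subseteq> H" using M(1) unfolding H_def by auto
  ultimately show ?thesis using that[OF H] by simp
qed

section \<open>Trees given by a parent map\<close>

text \<open>A walk becomes a path when the loop is cut out each time a vertex recurs.\<close>

lemma gpath_of_walk:
  assumes "(u, v) \<in> {(x, y). x \<in> V \<and> y \<in> V \<and> {x, y} \<in> E}\<^sup>*" "v \<in> V"
  obtains p where "gpath V E p" "hd p = u" "last p = v"
proof -
  have "\<exists>p. gpath V E p \<and> hd p = u \<and> last p = v"
    using assms(1)
  proof (induction rule: converse_rtrancl_induct)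
    case base
    have "gpath V E [v]" using assms(2) by (simp add: gpath_def)
    then show ?case by (intro exI[of _ "[v]"]) simp
  next
    case (step u w)
    then obtain p where p: "gpath V E p" "hd p = w" "last p = v" by blast
    show ?case
    proof (cases "u \<in> set p")
      case True
      then obtain a b where ab: "p = a @ u # b" by (meson split_list)
      have "gpath V E (u # b)"
        using p(1) unfolding gpath_def ab by (auto simp: successively_append_iff)
      moreover have "last (u # b) = v" using p(3) ab by simp
      ultimately show ?thesis by (intro exI[of _ "u # b"]) simp
    next
      case False
      have "gpath V E (u # p)"
        using p step(1) False unfolding gpath_def by (auto simp: successively_Cons)
      then show ?thesis using p by (intro exI[of _ "u # p"]) (simp add: gpath_def)
    qed
  qed
  then show ?thesis using that by blast
qed

text \<open>The edges of a rooted tree join each vertex other than the root to its parent. The rank is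
  any function that decreases towards the root; it makes induction towards the root possible and
  excludes cycles.\<close>

locale parent_tree =
  fixes V :: "'v set" and E :: "'v set set" and r :: 'v and par :: "'v \<Rightarrow> 'v" and rank :: "'v \<Rightarrow> nat"
  assumes finite_V: "finite V" and root_in: "r \<in> V"
    and par_in: "\<And>u. u \<in> V \<Longrightarrow> u \<noteq> r \<Longrightarrow> par u \<in> V"
    and par_rank: "\<And>u. u \<in> V \<Longrightarrow> u \<noteq> r \<Longrightarrow> rank (par u) < rank u"
    and edges_par: "E = (\<lambda>u. {u, par u}) ` (V - {r})"
begin

lemma par_neq: "u \<in> V \<Longrightarrow> u \<noteq> r \<Longrightarrow> par u \<noteq> u"
  using par_rank by (metis less_irrefl)

lemma edge_iff:
  assumes "u \<in> V" "v \<in> V"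
  shows "{u, v} \<in> E \<longleftrightarrow> u \<noteq> r \<and> v = par u \<or> v \<noteq> r \<and> u = par v"
  unfolding edges_par using assms by (auto simp: doubleton_eq_iff)

lemma par_edge_inj:
  assumes "u \<in> V - {r}" "v \<in> V - {r}" "{u, par u} = {v, par v}"
  shows "u = v"
  using assms par_rank[of u] par_rank[of v] by (auto simp: doubleton_eq_iff)

lemma is_graph: "is_graph V E"
  unfolding is_graph_def edges_par using finite_V par_in par_neq
  by (auto simp: card_insert_if) metis

definition children :: "'v \<Rightarrow> 'v set" where
  "children v = {u \<in> V - {r}. par u = v}"

lemma finite_children: "finite (children v)"
  unfolding children_def using finite_V by simp

lemma incident_edges:
  assumes "v \<in> V"
  shows "{e \<in> E. v \<in> e} = (\<lambda>u. {u, par u}) ` (children v \<union> ({v} - {r}))"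
  unfolding edges_par children_def using assms by auto

lemma card_incident_edges:
  assumes "v \<in> V"
  shows "card {e \<in> E. v \<in> e} = card (children v) + (if v = r then 0 else 1)"
proof -
  let ?S = "children v \<union> ({v} - {r})"
  have "inj_on (\<lambda>u. {u, par u}) ?S"
    using par_edge_inj assms unfolding children_def inj_on_def by auto
  then have "card {e \<in> E. v \<in> e} = card ?S"
    unfolding incident_edges[OF assms] by (rule card_image)
  also have "v \<notin> children v" using par_neq by (auto simp: children_def)
  then have "card ?S = card (children v) + (if v = r then 0 else 1)"
    using finite_children by (auto simp: card_insert_if)
  finally show ?thesis .
qed

lemma par_induct [consumes 1, case_names root step]:
  assumes "u \<in> V" and "P r"
    and step: "\<And>u. u \<in> V \<Longrightarrow> u \<noteq> r \<Longrightarrow> P (par u) \<Longrightarrow> P u"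
  shows "P u"
  using assms(1)
proof (induction "rank u" arbitrary: u rule: less_induct)
  case less
  show ?case
  proof (cases "u = r")
    case False
    then have "P (par u)" using less par_in par_rank by simp
    then show ?thesis using step less.prems False by simp
  qed (use assms(2) in simp)
qed

lemma walk_to_root:
  assumes "u \<in> V"
  shows "(u, r) \<in> {(x, y). x \<in> V \<and> y \<in> V \<and> {x, y} \<in> E}\<^sup>*"
  using assms
proof (induction rule: par_induct)
  case (step u)
  then have "(u, par u) \<in> {(x, y). x \<in> V \<and> y \<in> V \<and> {x, y} \<in> E}"
    using edge_iff par_in by simp
  then show ?case using step by (meson converse_rtrancl_into_rtrancl)
qed simp

lemma connected:
  assumes "u \<in> V" "v \<in> V"
  shows "\<exists>p. gpath V E p \<and> hd p = u \<and> last p = v"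
proof -
  let ?R = "{(x, y). x \<in> V \<and> y \<in> V \<and> {x, y} \<in> E}"
  have "sym ?R" by (auto simp: sym_def insert_commute)
  then have "(r, v) \<in> ?R\<^sup>*" by (rule symD[OF sym_rtrancl walk_to_root[OF assms(2)]])
  then have "(u, v) \<in> ?R\<^sup>*" using walk_to_root[OF assms(1)] by simp
  then obtain p where "gpath V E p" "hd p = u" "last p = v"
    using assms(2) by (rule gpath_of_walk)
  then show ?thesis by blast
qed

text \<open>A vertex of maximal rank on a cycle would have two different neighbours of at most the same
  rank, but only the parent of a vertex can be such a neighbour.\<close>

lemma no_cycle: "\<not> gcycle V E p"
proof
  assume "gcycle V E p"
  then have p: "set p \<subseteq> V" "distinct p" "3 \<le> length p" "{last p, hd p} \<in> E"
    "successively (\<lambda>u v. {u, v} \<in> E) p" by (auto simp: gcycle_def gpath_def)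
  let ?k = "length p"
  have adj: "{p ! i, p ! (Suc i mod ?k)} \<in> E" if "i < ?k" for i
  proof (cases "Suc i < ?k")
    case True
    then show ?thesis using p(5) by (simp add: successively_conv_nth)
  next
    case False
    then have "Suc i = ?k" using that by simp
    then have "i = ?k - 1" "Suc i mod ?k = 0" by auto
    moreover have "last p = p ! (?k - 1)" "hd p = p ! 0"
      using p(3) last_conv_nth[of p] hd_conv_nth[of p] by force+
    ultimately show ?thesis using p(4) by simp
  qed
  have "Max (rank ` set p) \<in> rank ` set p" using p(3) by (intro Max_in) auto
  then obtain v where v: "v \<in> set p" "rank v = Max (rank ` set p)" by (elim imageE) simp
  have v_max: "rank w \<le> rank v" if "w \<in> set p" for w
    unfolding v(2) using that by (intro Max_ge) auto
  obtain i where i: "i < ?k" "v = p ! i" using v(1) by (metis in_set_conv_nth)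
  have up: "w = par v" if "w \<in> set p" "{v, w} \<in> E" for w
  proof (rule ccontr)
    assume "w \<noteq> par v"
    moreover have "v \<in> V" "w \<in> V" using that v(1) p(1) by auto
    ultimately have "w \<noteq> r" "v = par w" using that(2) edge_iff by auto
    then have "rank v < rank w" using par_rank \<open>w \<in> V\<close> by simp
    then show False using v_max[OF that(1)] by simp
  qed
  \<comment> \<open>\<open>j\<close> and \<open>m\<close> are the positions of the cyclic neighbours of \<open>v\<close>; they differ as the cycle has length at least 3\<close>
  define j where "j = Suc i mod ?k"
  define m where "m = (if i = 0 then ?k - 1 else i - 1)"
  have m: "m < ?k" "Suc m mod ?k = i" using i p(3) by (auto simp: m_def)
  have "j < ?k" unfolding j_def using p(3) by (intro mod_less_divisor) linarith
  have "p ! j = par v" using up[of "p ! j"] adj[OF i(1)] i \<open>j < ?k\<close> by (simp add: j_def)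
  moreover have "p ! m = par v"
    using up[of "p ! m"] adj[OF m(1)] i m by (simp add: insert_commute)
  ultimately have "j = m" using nth_eq_iff_index_eq[OF p(2) \<open>j < ?k\<close> m(1)] by simp
  moreover have "j = (if Suc i = ?k then 0 else Suc i)" using i by (simp add: j_def)
  ultimately show False using i p(3) by (auto simp: m_def split: if_splits)
qed

lemma is_tree: "is_tree V E"
proof -
  have "V \<noteq> {}" using root_in by blast
  then show ?thesis
    unfolding is_tree_def by (intro conjI ballI notI is_graph connected) (auto simp: no_cycle)
qed


end

section \<open>Trees with a given hierarchy of clusters\<close>

text \<open>A tree whose vertices correspond to the members of a hierarchy \<open>H\<close> through \<open>c\<close>, the
  edges being the covering pairs. Up to isomorphism \<open>H\<close> determines the tree; carrying an arbitrary
  bijection \<open>c\<close> along lets the same facts apply to rooted trees on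
  any type of vertices, to contractions and to the model below.\<close>

locale cluster_tree =
  fixes n :: nat and H :: "nat set set" and T :: "'v ltree" and c :: "'v \<Rightarrow> nat set"
  assumes H: "hierarchy n H"
    and c_bij: "bij_betw c (vertices T) H"
    and edges_eq: "edges T =
      {{u, v} | u v. u \<in> vertices T \<and> v \<in> vertices T \<and> covers H (c u) (c v)}"
    and root_vertex: "root_vertex T \<in> vertices T" "c (root_vertex T) = {1..n}"
    and leaf: "\<And>i. i \<in> {1..n} \<Longrightarrow> leaf T i \<in> vertices T" "\<And>i. i \<in> {1..n} \<Longrightarrow> c (leaf T i) = {i}"
begin

abbreviation "V \<equiv> vertices T"
abbreviation "r \<equiv> root_vertex T"

lemma c_mem: "v \<in> V \<Longrightarrow> c v \<in> H"
  using c_bij by (auto simp: bij_betw_def)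

lemma c_inj: "u \<in> V \<Longrightarrow> v \<in> V \<Longrightarrow> c u = c v \<Longrightarrow> u = v"
  using c_bij by (auto simp: bij_betw_def inj_on_def)

lemma c_surj: "A \<in> H \<Longrightarrow> \<exists>v\<in>V. c v = A"
  using c_bij by (auto simp: bij_betw_def)

lemma c_props: "v \<in> V \<Longrightarrow> c v \<subseteq> {1..n}" "v \<in> V \<Longrightarrow> c v \<noteq> {}" "v \<in> V \<Longrightarrow> finite (c v)"
  using hierarchy_mem[OF H c_mem] by auto

lemma finite_vertices: "finite V"
  using c_bij hierarchy_finite[OF H] by (simp add: bij_betw_finite)

lemma n_ge_2: "2 \<le> n" using H by (simp add: hierarchy_def)

definition parent :: "'v \<Rightarrow> 'v" where
  "parent u = (THE v. v \<in> V \<and> covers H (c u) (c v))"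

lemma parent_eqI:
  assumes "v \<in> V" "covers H (c u) (c v)" shows "parent u = v"
  unfolding parent_def
proof (rule the_equality)
  show "v \<in> V \<and> covers H (c u) (c v)" using assms by simp
  fix w assume "w \<in> V \<and> covers H (c u) (c w)"
  then show "w = v" using covers_unique[of H "c u" "c w" "c v"] assms c_inj by metis
qed

lemma c_root_iff: "u \<in> V \<Longrightarrow> c u = {1..n} \<longleftrightarrow> u = r"
  using root_vertex c_inj by metis

lemma parent:
  assumes "u \<in> V" "u \<noteq> r"
  shows "parent u \<in> V" "covers H (c u) (c (parent u))" "c u \<subset> c (parent u)" "parent u \<noteq> u"
proof -
  have "c u \<noteq> {1..n}" using assms c_root_iff by simp
  then obtain B where B: "covers H (c u) B" using covers_exists[OF H c_mem[OF assms(1)]] by metis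
  then obtain v where "v \<in> V" "c v = B" using c_surj coversD(2) by metis
  then have v: "v \<in> V" "covers H (c u) (c v)" "parent u = v" using B parent_eqI by auto
  show "parent u \<in> V" "covers H (c u) (c (parent u))" using v by auto
  show "c u \<subset> c (parent u)" using coversD(3)[OF v(2)] v(3) by simp
  then show "parent u \<noteq> u" by auto
qed

lemma covers_root: "\<not> covers H (c r) A"
proof
  assume *: "covers H (c r) A"
  show False using hierarchy_mem(1)[OF H coversD(2)[OF *]] coversD(3)[OF *] root_vertex by simp
qed

lemma covers_iff: "u \<in> V \<Longrightarrow> v \<in> V \<Longrightarrow> covers H (c u) (c v) \<longleftrightarrow> u \<noteq> r \<and> v = parent u"
  using parent(2) parent_eqI covers_root by metis

lemma edges_parent: "edges T = (\<lambda>u. {u, parent u}) ` (V - {r})"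
  unfolding edges_eq using covers_iff parent(1) by fastforce

sublocale parent_tree V "edges T" r parent "\<lambda>v. n - card (c v)"
proof
  show "n - card (c (parent u)) < n - card (c u)" if "u \<in> V" "u \<noteq> r" for u
  proof -
    have p: "parent u \<in> V" "c u \<subset> c (parent u)" using parent[OF that] by auto
    have "card (c u) < card (c (parent u))" using p c_props(3) by (intro psubset_card_mono) auto
    moreover have "card (c (parent u)) \<le> n" using card_mono[OF _ c_props(1)[OF p(1)]] by simp
    ultimately show ?thesis by simp
  qed
qed (use finite_vertices root_vertex parent edges_parent in auto)

lemma card_children:
  assumes "v \<in> V" shows "card (children v) = card {B. covers H B (c v)}"
proof -
  have "{B. covers H B (c v)} = c ` children v"
  proof (intro equalityI subsetI)
    fix B assume "B \<in> {B. covers H B (c v)}"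
    then have B: "covers H B (c v)" by simp
    then obtain u where u: "u \<in> V" "c u = B" using c_surj coversD(1) by metis
    then have "u \<in> children v" using covers_iff[OF u(1) assms] B u by (auto simp: children_def)
    then show "B \<in> c ` children v" using u by blast
  next
    fix B assume "B \<in> c ` children v"
    then show "B \<in> {B. covers H B (c v)}" using parent(2) by (auto simp: children_def)
  qed
  moreover have "inj_on c (children v)"
    using c_bij by (auto simp: bij_betw_def inj_on_def children_def)
  ultimately show ?thesis by (simp add: card_image)
qed

lemma degree:
  "v \<in> V \<Longrightarrow> degree_in T v = card (children v) + (if v = r then 0 else 1)"
  unfolding degree_in_def by (rule card_incident_edges)

lemma no_children:
  assumes "v \<in> V" "is_singleton (c v)" shows "children v = {}"
proof -
  obtain i where i: "c v = {i}" using assms(2) by (auto simp: is_singleton_def)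
  have False if "u \<in> children v" for u
    using that parent(3)[of u] c_props(2)[of u] i by (auto simp: children_def)
  then show ?thesis by blast
qed

lemma many_children:
  assumes "v \<in> V" "\<not> is_singleton (c v)" shows "2 \<le> card (children v)"
proof -
  obtain x where "x \<in> c v" using c_props(2)[OF assms(1)] by blast
  from two_children[OF H c_mem[OF assms(1)] assms(2) this]
  obtain B C where BC: "covers H B (c v)" "covers H C (c v)" "B \<noteq> C" by metis
  have "finite {B. covers H B (c v)}"
    using hierarchy_finite[OF H] by (rule finite_subset[rotated]) (auto simp: covers_def)
  then have "card {B, C} \<le> card {B. covers H B (c v)}" using BC by (intro card_mono) auto
  then show ?thesis using BC(3) card_children[OF assms(1)] by simp
qed

lemma root_not_singleton: "\<not> is_singleton (c r)"
  using root_vertex(2) n_ge_2 by (simp add: is_singleton_altdef)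

lemma leaves_iff: "v \<in> leaves T \<longleftrightarrow> v \<in> V \<and> is_singleton (c v)"
proof (cases "v \<in> V")
  case True
  show ?thesis
    using no_children[OF True] many_children[OF True] degree[OF True] root_not_singleton True
    unfolding leaves_def by (cases "is_singleton (c v)") auto
qed (simp add: leaves_def)

lemma leaf_bij: "bij_betw (leaf T) {1..n} (leaves T)"
  unfolding bij_betw_def
proof (intro conjI equalityI subsetI)
  show "inj_on (leaf T) {1..n}" using leaf by (intro inj_onI) (metis singleton_inject)
  fix v assume "v \<in> leaves T"
  then have v: "v \<in> V" "is_singleton (c v)" using leaves_iff by auto
  then obtain i where i: "c v = {i}" by (auto simp: is_singleton_def)
  then have "i \<in> {1..n}" using c_props(1)[OF v(1)] by auto
  then have "v = leaf T i" using leaf c_inj i v(1) by metis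
  then show "v \<in> leaf T ` {1..n}" using \<open>i \<in> {1..n}\<close> by blast
next
  fix v assume "v \<in> leaf T ` {1..n}"
  then show "v \<in> leaves T" using leaf leaves_iff by auto
qed

lemma path_to_root:
  assumes "u \<in> V"
  shows "\<exists>p. gpath V (edges T) p \<and> hd p = u \<and> last p = r \<and> (\<forall>x\<in>set p. c u \<subseteq> c x)"
  using assms
proof (induction rule: par_induct)
  case root
  then show ?case using root_vertex by (intro exI[of _ "[r]"]) (simp add: gpath_def)
next
  case (step u)
  then obtain p where p: "gpath V (edges T) p" "hd p = parent u" "last p = r"
    "\<forall>x\<in>set p. c (parent u) \<subseteq> c x" by blast
  have par: "c u \<subset> c (parent u)" "parent u \<in> V" using parent step by auto
  then have "u \<notin> set p" using p(4) by blast
  moreover have "{u, parent u} \<in> edges T" using edge_iff par step by simp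
  ultimately have "gpath V (edges T) (u # p)"
    using p step(1) unfolding gpath_def by (auto simp: successively_Cons)
  then show ?case using p par by (intro exI[of _ "u # p"]) (auto simp: gpath_def)
qed

lemma rooted_tree: "rooted_tree n T"
proof -
  have "1 < degree_in T r"
    using degree[OF root_vertex(1)] many_children[OF root_vertex(1) root_not_singleton] by simp
  moreover have "3 \<le> degree_in T v" if "v \<in> V - leaves T - {r}" for v
  proof -
    have v: "v \<in> V" "\<not> is_singleton (c v)" "v \<noteq> r" using that leaves_iff by auto
    then show ?thesis using degree[OF v(1)] many_children[OF v(1,2)] by simp
  qed
  ultimately show ?thesis
    unfolding rooted_tree_def using is_tree root_vertex leaf_bij by auto
qed

text \<open>The edge to the parent begins a path to the root. A path that begins with the edge to a child
  stays strictly below \<open>v\<close>, since it could leave the part below \<open>v\<close> only through \<open>v\<close> itself. So the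
  edges counted by the outdegree are those to the children.\<close>

lemma outdegree:
  assumes "v \<in> V" shows "outdegree T v = card (children v)"
proof -
  define on where
    "on e \<longleftrightarrow> (\<exists>p. gpath V (edges T) p \<and> hd p = v \<and> last p = r \<and> e \<in> gpath_edges p)" for e
  have up: "on {v, parent v}" if vr: "v \<noteq> r"
  proof -
    obtain p where p: "gpath V (edges T) p" "hd p = parent v" "last p = r"
      "\<forall>x\<in>set p. c (parent v) \<subseteq> c x"
      using path_to_root[OF parent(1)[OF assms vr]] by blast
    have "p \<noteq> []" using p(1) by (simp add: gpath_def)
    have "v \<notin> set p" using p(4) parent(3)[OF assms vr] by blast
    moreover have "{v, parent v} \<in> edges T" using edge_iff assms vr parent(1) by simp
    ultimately have "gpath V (edges T) (v # p)"
      using p assms unfolding gpath_def by (auto simp: successively_Cons)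
    moreover have "{v, parent v} \<in> gpath_edges (v # p)"
      unfolding gpath_edges_def using \<open>p \<noteq> []\<close> p(2)
      by (intro CollectI exI[of _ 0]) (simp add: hd_conv_nth)
    ultimately show ?thesis unfolding on_def using p(3) \<open>p \<noteq> []\<close> by (intro exI[of _ "v # p"]) simp
  qed
  have down: "\<not> on {u, parent u}" if u: "u \<in> children v" for u
  proof
    assume "on {u, parent u}"
    then obtain p where p: "gpath V (edges T) p" "hd p = v" "last p = r" "{u, parent u} \<in> gpath_edges p"
      unfolding on_def by blast
    have uv: "u \<in> V" "u \<noteq> r" "parent u = v" using u by (auto simp: children_def)
    have p': "p \<noteq> []" "distinct p" "set p \<subseteq> V" using p(1) by (auto simp: gpath_def)
    obtain i where i: "Suc i < length p" "{u, v} = {p ! i, p ! Suc i}"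
      using p(4) uv(3) by (auto simp: gpath_edges_def)
    have p0: "p ! 0 = v" using p(2) p' by (simp add: hd_conv_nth)
    have "v \<in> {p ! i, p ! Suc i}" unfolding i(2)[symmetric] by simp
    then have "p ! 0 = p ! i \<or> p ! 0 = p ! Suc i" using p0 by simp
    then have "i = 0"
      using nth_eq_iff_index_eq[OF p'(2), of 0 i] nth_eq_iff_index_eq[OF p'(2), of 0 "Suc i"] i(1)
      by linarith
    moreover have "u \<in> {p ! i, p ! Suc i}" unfolding i(2)[symmetric] by simp
    ultimately have "u \<in> {v, p ! Suc 0}" using p0 by simp
    then have p1: "p ! Suc 0 = u" using parent(4)[OF uv(1,2)] uv(3) by auto
    have below: "c (p ! Suc j) \<subset> c v" if "Suc j < length p" for j
      using that
    proof (induction j)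
      case 0
      then show ?case using p1 parent(3)[OF uv(1,2)] uv(3) by simp
    next
      case (Suc j)
      let ?x = "p ! Suc j" and ?y = "p ! Suc (Suc j)"
      have xy: "?x \<in> V" "?y \<in> V" "{?x, ?y} \<in> edges T"
        using Suc.prems p'(3) p(1) by (auto simp: gpath_def successively_conv_nth)
      have IH: "c ?x \<subset> c v" using Suc by simp
      have "?y \<noteq> v"
        using p0 Suc.prems nth_eq_iff_index_eq[OF p'(2), of 0 "Suc (Suc j)"]
        by (metis Zero_not_Suc length_greater_0_conv p'(1))
      consider "?x \<noteq> r" "?y = parent ?x" | "?y \<noteq> r" "?x = parent ?y"
        using xy(3) edge_iff[OF xy(1,2)] by blast
      then show ?case
      proof cases
        case 1
        have "c ?y \<subseteq> c v"
          using coversD(4)[OF parent(2)[OF xy(1) 1(1)] c_mem[OF assms] IH] 1(2) by simp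
        then show ?thesis using \<open>?y \<noteq> v\<close> c_inj[OF xy(2) assms] by blast
      next
        case 2
        then show ?thesis using parent(3)[OF xy(2)] IH by auto
      qed
    qed
    have "length p \<noteq> 0" "length p \<noteq> 1" using i by auto
    then have "Suc (length p - 2) = length p - 1" "Suc (length p - 2) < length p" by linarith+
    then have "c r \<subset> c v" using below[of "length p - 2"] p(3) p'(1) by (simp add: last_conv_nth)
    then show False using c_props(1)[OF assms] root_vertex(2) by auto
  qed
  have "{e \<in> edges T. v \<in> e \<and> \<not> on e} = {e \<in> {e \<in> edges T. v \<in> e}. \<not> on e}" by simp
  also have "\<dots> = (\<lambda>u. {u, parent u}) ` children v"
    unfolding incident_edges[OF assms] using up down by auto
  finally have "outdegree T v = card ((\<lambda>u. {u, parent u}) ` children v)"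
    unfolding outdegree_def on_def by simp
  also have "\<dots> = card (children v)"
    using par_edge_inj by (intro card_image inj_onI) (auto simp: children_def)
  finally show ?thesis .
qed

lemma binary_tree: "binary_hierarchy H \<Longrightarrow> binary_tree n T"
  unfolding binary_tree_def binary_hierarchy_def
  by (intro conjI ballI rooted_tree) (simp add: outdegree card_children leaves_iff c_mem)

definition inner :: "'v set" where
  "inner = {u \<in> V. c u \<in> proper_clusters n}"

lemma inner_iff: "u \<in> inner \<longleftrightarrow> u \<in> V \<and> u \<noteq> r \<and> \<not> is_singleton (c u)"
proof
  assume "u \<in> inner"
  then show "u \<in> V \<and> u \<noteq> r \<and> \<not> is_singleton (c u)"
    using root_vertex(2) by (auto simp: inner_def proper_clusters_def is_singleton_altdef)
next
  assume u: "u \<in> V \<and> u \<noteq> r \<and> \<not> is_singleton (c u)"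
  then have "u \<in> V" by simp
  then have "c u \<in> proper_clusters n"
    by (rule hierarchy_cases[OF H c_mem]) (use u c_root_iff in auto)
  then show "u \<in> inner" using u by (simp add: inner_def)
qed

lemma internal_edges: "internal_edges T = (\<lambda>u. {u, parent u}) ` inner"
proof -
  have "{u, parent u} \<inter> leaves T = {} \<longleftrightarrow> \<not> is_singleton (c u)" if u: "u \<in> V - {r}" for u
  proof -
    have p: "parent u \<in> V" "c u \<subset> c (parent u)" using parent u by auto
    then have "\<not> is_singleton (c (parent u))" using c_props(2)[of u] u
      by (auto simp: is_singleton_def)
    then show ?thesis using u p leaves_iff by auto
  qed
  then show ?thesis unfolding internal_edges_def edges_parent using inner_iff by auto
qed

end

text \<open>A model of a hierarchy whose vertices are natural numbers, as the members of a combinatorial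
  type have to be.\<close>

definition encoded_tree :: "nat \<Rightarrow> nat set set \<Rightarrow> nat ltree" where
  "encoded_tree n H =
     \<lparr>vertices = set_encode ` H,
      edges = {{set_encode A, set_encode B} | A B. covers H A B},
      root_vertex = set_encode {1..n},
      leaf = (\<lambda>i. set_encode {i})\<rparr>"

lemma cluster_tree_encoded:
  assumes "hierarchy n H"
  shows "cluster_tree n H (encoded_tree n H) set_decode"
proof -
  have dec: "set_decode (set_encode A) = A" if "A \<in> H" for A
    using hierarchy_mem[OF assms that] by simp
  show ?thesis
  proof
    show "bij_betw set_decode (vertices (encoded_tree n H)) H"
      by (rule bij_betw_byWitness[where f' = set_encode]) (auto simp: encoded_tree_def dec)
    show "edges (encoded_tree n H) = {{u, v} | u v. u \<in> vertices (encoded_tree n H) \<and>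
        v \<in> vertices (encoded_tree n H) \<and> covers H (set_decode u) (set_decode v)}" (is "?L = ?R")
    proof (intro equalityI subsetI)
      fix e assume "e \<in> ?L"
      then obtain A B where AB: "covers H A B" "e = {set_encode A, set_encode B}"
        by (auto simp: encoded_tree_def)
      have "A \<in> H" "B \<in> H" using AB(1) by (rule coversD)+
      then show "e \<in> ?R"
        using AB by (intro CollectI exI[of _ "set_encode A"] exI[of _ "set_encode B"])
          (simp add: encoded_tree_def dec)
    next
      fix e assume "e \<in> ?R"
      then show "e \<in> ?L" by (auto simp: encoded_tree_def dec) blast
    qed
    show "root_vertex (encoded_tree n H) \<in> vertices (encoded_tree n H)"
      "set_decode (root_vertex (encoded_tree n H)) = {1..n}"
      unfolding encoded_tree_def ltree.simps
      using imageI[OF hierarchy_top[OF assms]] dec[OF hierarchy_top[OF assms]] .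
    fix i assume "i \<in> {1..n}"
    then have "{i} \<in> H" by (rule hierarchy_singleton[OF assms])
    then show "leaf (encoded_tree n H) i \<in> vertices (encoded_tree n H)"
      "set_decode (leaf (encoded_tree n H) i) = {i}"
      unfolding encoded_tree_def ltree.simps using imageI[of "{i}" H] dec[of "{i}"] by blast+
  qed (rule assms)
qed

section \<open>The hierarchy of a rooted tree\<close>

lemma walk_of_gpath:
  assumes "gpath V E p"
  shows "(hd p, last p) \<in> {(x, y). x \<in> V \<and> y \<in> V \<and> {x, y} \<in> E}\<^sup>*"
  using assms
proof (induction p)
  case (Cons u p)
  show ?case
  proof (cases "p = []")
    case False
    then have "gpath V E p" "{u, hd p} \<in> E" "u \<in> V" "hd p \<in> V"
      using Cons.prems unfolding gpath_def by (auto simp: successively_Cons)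
    then show ?thesis using Cons.IH False by (auto intro: converse_rtrancl_into_rtrancl)
  qed simp
qed (simp add: gpath_def)

text \<open>Let \<open>d\<close> behave like a distance from the root: every other vertex has a neighbour of
  smaller value. Two different neighbours of \<open>v\<close> of at most the value of \<open>v\<close>
  could both descend to the root without meeting \<open>v\<close>; this connects
  them outside of \<open>v\<close> and closes a cycle through \<open>v\<close>.\<close>

lemma no_second_lower_neighbour:
  assumes tree: "is_tree V E" and dist: "\<And>x. x \<in> V \<Longrightarrow> x \<noteq> r \<Longrightarrow> \<exists>w\<in>V. {x, w} \<in> E \<and> d w < (d x :: nat)"
    and v: "v \<in> V" "v \<noteq> r" "r \<in> V"
    and w: "w \<in> V" "{v, w} \<in> E" "d w \<le> d v" and w': "w' \<in> V" "{v, w'} \<in> E" "d w' \<le> d v"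
  shows "w = w'"
proof (rule ccontr)
  assume "w \<noteq> w'"
  let ?R = "{(x, y). x \<in> V - {v} \<and> y \<in> V - {v} \<and> {x, y} \<in> E}"
  have loop: "x \<noteq> y" if "{x, y} \<in> E" for x y
    using that tree unfolding is_tree_def is_graph_def by (metis card_1_singleton_iff doubleton_eq_iff insert_absorb2 numeral_eq_one_iff One_nat_def semiring_norm(85))
  have down: "(x, r) \<in> ?R\<^sup>*" if "x \<in> V" "x \<noteq> v" "d x \<le> d v" for x
    using that
  proof (induction "d x" arbitrary: x rule: less_induct)
    case less
    show ?case
    proof (cases "x = r")
      case False
      then obtain y where y: "y \<in> V" "{x, y} \<in> E" "d y < d x" using dist less.prems by blast
      then have "y \<noteq> v" using less.prems by auto
      then have "(y, r) \<in> ?R\<^sup>*" using less y by simp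
      moreover have "(x, y) \<in> ?R" using less.prems y \<open>y \<noteq> v\<close> by simp
      ultimately show ?thesis by (rule converse_rtrancl_into_rtrancl[rotated])
    qed simp
  qed
  have "sym ?R" by (auto simp: sym_def insert_commute)
  have "w \<noteq> v" "w' \<noteq> v" using loop w w' by auto
  have "(r, w') \<in> ?R\<^sup>*"
    by (rule symD[OF sym_rtrancl[OF \<open>sym ?R\<close>] down[OF w'(1) \<open>w' \<noteq> v\<close> w'(3)]])
  with down[OF w(1) \<open>w \<noteq> v\<close> w(3)] have "(w, w') \<in> ?R\<^sup>*" by (rule rtrancl_trans)
  moreover have "w' \<in> V - {v}" using w'(1) \<open>w' \<noteq> v\<close> by simp
  ultimately obtain p where p: "gpath (V - {v}) E p" "hd p = w" "last p = w'"
    by (rule gpath_of_walk)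
  then have p': "p \<noteq> []" "set p \<subseteq> V - {v}" "distinct p" "successively (\<lambda>u v. {u, v} \<in> E) p"
    by (auto simp: gpath_def)
  obtain x q where xq: "p = x # q" using p'(1) by (cases p) auto
  have "q \<noteq> []" using p(2,3) \<open>w \<noteq> w'\<close> xq by auto
  then have "3 \<le> length (v # p)" using xq by (cases q) auto
  moreover have "gpath V E (v # p)"
    using p' v(1) w(2) p(2) unfolding gpath_def by (auto simp: successively_Cons)
  moreover have "{last (v # p), hd (v # p)} \<in> E" using p'(1) p(3) w'(2) by (simp add: insert_commute)
  ultimately have "gcycle V E (v # p)" unfolding gcycle_def by blast
  then show False using tree unfolding is_tree_def by blast
qed

text \<open>The rank is the distance from the root, and the parent of a vertex is its only neighbour that is not
  farther from the root. Adjacent vertices are comparable in this sense, so every edge joins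
  a vertex to its parent.\<close>

lemma parent_tree_of_tree:
  assumes tree: "is_tree V E" and r: "r \<in> V"
  obtains par d where "parent_tree V E r par d"
proof -
  let ?R = "{(x, y). x \<in> V \<and> y \<in> V \<and> {x, y} \<in> E}"
  define d where "d v = (LEAST k. (v, r) \<in> ?R ^^ k)" for v
  have graph: "finite V" "\<And>e. e \<in> E \<Longrightarrow> e \<subseteq> V \<and> card e = 2"
    using tree unfolding is_tree_def is_graph_def by auto
  have conn: "(v, r) \<in> ?R\<^sup>*" if v: "v \<in> V" for v
  proof -
    have "\<forall>u\<in>V. \<forall>v\<in>V. \<exists>p. gpath V E p \<and> hd p = u \<and> last p = v"
      using tree by (simp add: is_tree_def)
    from bspec[OF bspec[OF this v] r] obtain p where "gpath V E p" "hd p = v" "last p = r"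
      by (elim exE conjE)
    then show ?thesis using walk_of_gpath[of V E p] by simp
  qed
  have d: "(v, r) \<in> ?R ^^ d v" if "v \<in> V" for v
  proof -
    from conn[OF that] obtain k where "(v, r) \<in> ?R ^^ k" unfolding rtrancl_power by (elim exE)
    then show ?thesis unfolding d_def by (rule LeastI)
  qed
  have step: "\<exists>w\<in>V. {v, w} \<in> E \<and> d w < d v" if v: "v \<in> V" "v \<noteq> r" for v
  proof (cases "d v")
    case 0
    then show ?thesis using d[OF v(1)] v(2) by simp
  next
    case (Suc k)
    then have "(v, r) \<in> ?R ^^ Suc k" using d[OF v(1)] by simp
    then obtain w where w: "(v, w) \<in> ?R" "(w, r) \<in> ?R ^^ k" by (rule relpow_Suc_E2)
    have "d w \<le> k" unfolding d_def by (rule Least_le) (rule w(2))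
    then show ?thesis using w(1) Suc by auto
  qed
  define par where "par v = (SOME w. w \<in> V \<and> {v, w} \<in> E \<and> d w < d v)" for v
  have par: "par v \<in> V" "{v, par v} \<in> E" "d (par v) < d v" if v: "v \<in> V" "v \<noteq> r" for v
  proof -
    have "\<exists>w. w \<in> V \<and> {v, w} \<in> E \<and> d w < d v" using step[OF v] by blast
    from someI_ex[OF this] show "par v \<in> V" "{v, par v} \<in> E" "d (par v) < d v"
      unfolding par_def by auto
  qed
  have dr: "d r = 0" unfolding d_def by (intro Least_eq_0) simp
  have lower: "v = par u \<and> u \<noteq> r" if uv: "{u, v} \<in> E" "u \<in> V" "v \<in> V" "d v \<le> d u" "u \<noteq> v" for u v
  proof -
    have "u \<noteq> r"
    proof
      assume "u = r"
      then have "v \<noteq> r" "d v = 0" using uv dr by auto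
      then show False using step[OF uv(3)] by simp
    qed
    moreover have "v = par u"
      by (rule no_second_lower_neighbour[of V E r d u, OF tree step])
        (use uv r calculation par[OF uv(2) calculation] in auto)
    ultimately show ?thesis by simp
  qed
  have "parent_tree V E r par d"
  proof
    show "E = (\<lambda>u. {u, par u}) ` (V - {r})"
    proof (intro equalityI subsetI)
      fix e assume e: "e \<in> E"
      from graph(2)[OF e] obtain u v where uv: "e = {u, v}" "u \<noteq> v"
        unfolding card_2_iff by (elim conjE exE)
      then have V: "u \<in> V" "v \<in> V" using graph(2)[OF e] by auto
      consider "d v \<le> d u" | "d u \<le> d v" by linarith
      then show "e \<in> (\<lambda>u. {u, par u}) ` (V - {r})"
      proof cases
        case 1
        then show ?thesis using lower[of u v] uv V e by auto
      next
        case 2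
        then have "u = par v \<and> v \<noteq> r" using lower[of v u] uv V e by (simp add: insert_commute)
        then show ?thesis using uv(1) V by (auto simp: insert_commute)
      qed
    next
      fix e assume "e \<in> (\<lambda>u. {u, par u}) ` (V - {r})"
      then show "e \<in> E" using par(2) by auto
    qed
  qed (use graph(1) r par in auto)
  then show ?thesis by (rule that)
qed

context parent_tree
begin

definition up :: "('v \<times> 'v) set" where
  "up = {(u, par u) | u. u \<in> V - {r}}\<^sup>*"

lemma up_refl: "(v, v) \<in> up" unfolding up_def by simp

lemma up_trans: "(u, v) \<in> up \<Longrightarrow> (v, w) \<in> up \<Longrightarrow> (u, w) \<in> up"
  unfolding up_def by (rule rtrancl_trans)

lemma up_par: "u \<in> V \<Longrightarrow> u \<noteq> r \<Longrightarrow> (u, par u) \<in> up"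
  unfolding up_def by (intro r_into_rtrancl) blast

lemma up_cases:
  assumes "(u, v) \<in> up"
  obtains "u = v" | "u \<in> V" "u \<noteq> r" "(par u, v) \<in> up"
  by (rule converse_rtranclE[OF assms[unfolded up_def]]) (use that in \<open>auto simp: up_def\<close>)

lemma up_child_cases:
  assumes "(u, v) \<in> up"
  obtains "u = v" | w where "w \<in> children v" "(u, w) \<in> up"
  by (rule rtranclE[OF assms[unfolded up_def]]) (use that in \<open>auto simp: up_def children_def\<close>)

lemma up_rank:
  assumes "(u, v) \<in> up" shows "u = v \<or> rank v < rank u"
  using assms unfolding up_def
proof (induction rule: converse_rtrancl_induct)
  case (step u w)
  then show ?case using par_rank[of u] by auto
qed simp

lemma up_root: "u \<in> V \<Longrightarrow> (u, r) \<in> up"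
  by (induction rule: par_induct) (auto intro: up_refl up_trans up_par)

lemma up_comparable:
  assumes "(u, v) \<in> up" "(u, w) \<in> up" shows "(v, w) \<in> up \<or> (w, v) \<in> up"
proof -
  have "single_valued {(u, par u) | u. u \<in> V - {r}}" by (auto simp: single_valued_def)
  from single_valued_confluent[OF this assms[unfolded up_def]] show ?thesis unfolding up_def .
qed

lemma siblings_incomparable:
  assumes "k \<in> children v" "k' \<in> children v" "(k, k') \<in> up" shows "k = k'"
  using assms(3)
proof (cases rule: up_cases)
  case 2
  have "par k = v" "k' \<in> V - {r}" "par k' = v" using assms by (auto simp: children_def)
  then show ?thesis using up_rank[OF 2(3)] par_rank[of k'] by auto
qed

lemma childless_below:
  assumes "v \<in> V"
  shows "\<exists>x\<in>V. children x = {} \<and> (x, v) \<in> up"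
proof -
  let ?D = "{x \<in> V. (x, v) \<in> up}"
  have "Max (rank ` ?D) \<in> rank ` ?D" using finite_V assms up_refl by (intro Max_in) auto
  then obtain x where x: "x \<in> ?D" "rank x = Max (rank ` ?D)" by (elim imageE) simp
  have max: "rank y \<le> rank x" if "y \<in> ?D" for y
    unfolding x(2) using finite_V that by (intro Max_ge) auto
  have False if y: "y \<in> children x" for y
  proof -
    have "y \<in> V" "y \<noteq> r" "par y = x" using y by (auto simp: children_def)
    then have "y \<in> ?D" "rank x < rank y" using up_par up_trans x(1) par_rank by auto
    then show False using max[of y] by simp
  qed
  then show ?thesis using x(1) by blast
qed

end

text \<open>Take for \<open>c v\<close> the set of labels of the leaves below \<open>v\<close>. The vertices above a given leaf
  form a chain, which makes the clusters laminar. A vertex other than a leaf has two children, whose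
  clusters are nonempty and disjoint; hence the cluster grows strictly towards the root, and
  inclusion of clusters is the ancestor relation.\<close>

lemma cluster_tree_of_rooted_tree:
  assumes T: "rooted_tree n T"
  obtains H c where "cluster_tree n H T c"
proof -
  let ?V = "vertices T" and ?r = "root_vertex T"
  have tree: "is_tree ?V (edges T)" and r: "?r \<in> ?V" "1 < degree_in T ?r"
    and deg: "\<And>v. v \<in> ?V - leaves T - {?r} \<Longrightarrow> 3 \<le> degree_in T v"
    and lf: "bij_betw (leaf T) {1..n} (leaves T)"
    using T unfolding rooted_tree_def by auto
  obtain par d where "parent_tree ?V (edges T) ?r par d" by (rule parent_tree_of_tree[OF tree r(1)])
  then interpret parent_tree ?V "edges T" ?r par d .
  have degree: "degree_in T v = card (children v) + (if v = ?r then 0 else 1)" if "v \<in> ?V" for v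
    using card_incident_edges[OF that] unfolding degree_in_def .
  have leaves_iff: "v \<in> leaves T \<longleftrightarrow> children v = {}" if v: "v \<in> ?V" for v
  proof -
    have "v \<in> leaves T \<longleftrightarrow> degree_in T v = 1" using v by (simp add: leaves_def)
    then show ?thesis
      using degree[OF v] r(2) deg[of v] v finite_children[of v] by (cases "v = ?r") auto
  qed
  have two: "2 \<le> card (children v)" if v: "v \<in> ?V" "children v \<noteq> {}" for v
    using degree[OF v(1)] r(2) deg[of v] v leaves_iff[OF v(1)] by (cases "v = ?r") auto
  have leaf_in: "leaf T i \<in> ?V" "leaf T i \<in> leaves T" if "i \<in> {1..n}" for i
    using bij_betwE[OF lf] that by (simp_all add: leaves_def)
  have leaves_img: "leaf T ` {1..n} = leaves T" and leaf_inj: "inj_on (leaf T) {1..n}"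
    using lf by (simp_all add: bij_betw_def)
  define c where "c v = {i \<in> {1..n}. (leaf T i, v) \<in> up}" for v
  have c_ne: "c v \<noteq> {}" if v: "v \<in> ?V" for v
  proof -
    obtain x where x: "x \<in> ?V" "children x = {}" "(x, v) \<in> up" using childless_below[OF v] by blast
    then have "x \<in> leaves T" using leaves_iff by simp
    then have "x \<in> leaf T ` {1..n}" using leaves_img by simp
    then obtain i where "i \<in> {1..n}" "leaf T i = x" by (elim imageE) simp
    then show ?thesis using x(3) unfolding c_def by blast
  qed
  have c_mono: "c u \<subseteq> c v" if "(u, v) \<in> up" for u v
    using that up_trans unfolding c_def by blast
  have c_comparable: "(u, v) \<in> up \<or> (v, u) \<in> up" if "i \<in> c u" "i \<in> c v" for i u v
    using that up_comparable unfolding c_def by blast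
  have c_leaf: "c (leaf T i) = {i}" if i: "i \<in> {1..n}" for i
  proof -
    have "j = i" if j: "j \<in> {1..n}" "(leaf T j, leaf T i) \<in> up" for j
      using j(2)
    proof (cases rule: up_child_cases)
      case 1
      then show ?thesis by (rule inj_onD[OF leaf_inj _ j(1) i])
    next
      case 2
      then show ?thesis using leaves_iff leaf_in[OF i] by blast
    qed
    then show ?thesis using i up_refl unfolding c_def by blast
  qed
  have sibling: "\<exists>k'\<in>children v. c k' \<inter> c k = {}" if v: "v \<in> ?V" "k \<in> children v" for v k
  proof -
    have "2 \<le> card (children v)" using two[OF v(1)] v(2) by blast
    then have "\<not> children v \<subseteq> {k}" using card_mono[of "{k}" "children v"] by auto
    then obtain k' where k': "k' \<in> children v" "k' \<noteq> k" by blast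
    have "(k, k') \<notin> up" "(k', k) \<notin> up"
      using siblings_incomparable[OF v(2) k'(1)] siblings_incomparable[OF k'(1) v(2)] k'(2) by auto
    then have "c k' \<inter> c k = {}" using c_comparable by blast
    then show ?thesis using k'(1) by blast
  qed
  have c_strict: "c u \<subset> c v" if uv: "(u, v) \<in> up" "u \<noteq> v" "v \<in> ?V" for u v
    using uv(1)
  proof (cases rule: up_child_cases)
    case (2 k)
    obtain k' where k': "k' \<in> children v" "c k' \<inter> c k = {}" using sibling[OF uv(3) 2(1)] by blast
    then have "k' \<in> ?V" "(k', v) \<in> up" using up_par by (auto simp: children_def)
    then have "c k' \<noteq> {}" "c k' \<subseteq> c v" using c_ne c_mono by auto
    moreover have "c u \<subseteq> c k" "c u \<subseteq> c v" using c_mono 2(2) uv(1) by auto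
    ultimately show ?thesis using k'(2) by blast
  qed (use uv in simp)
  have c_iff: "c u \<subseteq> c v \<longleftrightarrow> (u, v) \<in> up" if uv: "u \<in> ?V" "v \<in> ?V" for u v
  proof
    assume sub: "c u \<subseteq> c v"
    obtain i where "i \<in> c u" using c_ne[OF uv(1)] by blast
    then have "(u, v) \<in> up \<or> (v, u) \<in> up" using c_comparable sub by blast
    then show "(u, v) \<in> up"
      using c_strict[of v u] sub uv up_refl by (cases "u = v") auto
  qed (rule c_mono)
  have c_inj: "u = v" if "u \<in> ?V" "v \<in> ?V" "c u = c v" for u v
    using c_iff[OF that(1,2)] c_strict[of u v] that by (cases "u = v") auto
  have c_root: "c ?r = {1..n}" using up_root leaf_in unfolding c_def by auto
  define H where "H = c ` ?V"
  have "hierarchy n H"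
    unfolding hierarchy_def
  proof (intro conjI)
    obtain k where k: "k \<in> children ?r" using two[OF r(1)] leaves_iff[OF r(1)] degree[OF r(1)] r(2)
      by (cases "children ?r = {}") auto
    then obtain k' where k': "k' \<in> children ?r" "c k' \<inter> c k = {}" using sibling[OF r(1)] by blast
    have "k \<in> ?V" "k' \<in> ?V" using k k' by (auto simp: children_def)
    then obtain i j where ij: "i \<in> c k" "j \<in> c k'" using c_ne[of k] c_ne[of k'] by auto
    then have "i \<noteq> j" "i \<in> {1..n}" "j \<in> {1..n}" using k'(2) by (auto simp: c_def)
    then show "2 \<le> n" by auto
    show "H \<subseteq> Pow {1..n}" unfolding H_def c_def by auto
    show "{} \<notin> H" unfolding H_def using c_ne by auto
    show "trivial_clusters n \<subseteq> H"
    proof -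
      have "{i} \<in> c ` ?V" if "i \<in> {1..n}" for i
        unfolding c_leaf[OF that, symmetric] using leaf_in(1)[OF that] by (rule imageI)
      moreover have "{1..n} \<in> c ` ?V" unfolding c_root[symmetric] using r(1) by (rule imageI)
      ultimately show ?thesis unfolding trivial_clusters_def H_def by auto
    qed
    show "laminar H"
      unfolding laminar_def H_def using c_comparable c_mono by (auto, blast)
  qed
  moreover have "bij_betw c ?V H" unfolding H_def bij_betw_def inj_on_def using c_inj by blast
  moreover have covers_iff: "covers H (c u) (c v) \<longleftrightarrow> u \<noteq> ?r \<and> v = par u" if uv: "u \<in> ?V" "v \<in> ?V" for u v
  proof -
    have par: "covers H (c u) (c (par u))" if ur: "u \<noteq> ?r"
      unfolding covers_def
    proof (intro conjI ballI impI)
      show "c u \<subset> c (par u)"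
        using c_strict[OF up_par[OF uv(1) ur]] par_neq[OF uv(1) ur] par_in[OF uv(1) ur] by auto
      fix C assume C: "C \<in> H" "c u \<subset> C"
      then obtain w where w: "w \<in> ?V" "C = c w" unfolding H_def by blast
      then have "(u, w) \<in> up" using c_iff[OF uv(1)] C by auto
      then show "c (par u) \<subseteq> C" using w C c_mono by (cases rule: up_cases) auto
    qed (use uv ur par_in in \<open>auto simp: H_def\<close>)
    show ?thesis
    proof
      assume cov: "covers H (c u) (c v)"
      have "(u, v) \<in> up" using c_iff[OF uv] coversD(3)[OF cov] by auto
      then have ur: "u \<noteq> ?r" using coversD(3)[OF cov] by (cases rule: up_cases) auto
      then have "c v = c (par u)" using covers_unique[OF cov par] by simp
      then show "u \<noteq> ?r \<and> v = par u" using c_inj uv par_in ur by auto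
    qed (use par in auto)
  qed
  have "edges T = {{u, v} | u v. u \<in> ?V \<and> v \<in> ?V \<and> covers H (c u) (c v)}" (is "_ = ?R")
  proof (intro equalityI subsetI)
    fix e assume "e \<in> edges T"
    then obtain u where "u \<in> ?V" "u \<noteq> ?r" "e = {u, par u}" unfolding edges_par by auto
    then show "e \<in> ?R"
      using covers_iff par_in by (intro CollectI exI[of _ u] exI[of _ "par u"]) auto
  next
    fix e assume "e \<in> ?R"
    then obtain u v where uv: "e = {u, v}" "u \<in> ?V" "v \<in> ?V" "covers H (c u) (c v)" by auto
    then show "e \<in> edges T" unfolding edges_par using covers_iff[OF uv(2,3)] by auto
  qed
  ultimately have "cluster_tree n H T c"
    using r(1) c_root leaf_in(1) c_leaf by unfold_locales
  then show ?thesis by (rule that)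
qed

section \<open>Combinatorial types and hierarchies\<close>

text \<open>The labels \<open>i\<close> such that removing the point \<open>x\<close> cuts \<open>b i\<close> off from \<open>a\<close>. With \<open>a\<close> the root
  and \<open>b\<close> the leaves of a realized tree, this is the cluster at \<open>x\<close> expressed in topological terms.\<close>

definition separated_labels ::
  "nat \<Rightarrow> 'a::topological_space set \<Rightarrow> 'a \<Rightarrow> (nat \<Rightarrow> 'a) \<Rightarrow> 'a \<Rightarrow> nat set" where
  "separated_labels n X a b x =
     {i \<in> {1..n}. \<nexists>S. connected S \<and> S \<subseteq> X - {x} \<and> a \<in> S \<and> b i \<in> S}"

lemma separated_labels_base: "separated_labels n X a b a = {1..n}"
proof (rule Set.set_eqI)
  fix i
  have "\<nexists>S. connected S \<and> S \<subseteq> X - {a} \<and> a \<in> S \<and> b i \<in> S" by blast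
  then show "i \<in> separated_labels n X a b a \<longleftrightarrow> i \<in> {1..n}"
    unfolding separated_labels_def by (simp only: mem_Collect_eq simp_thms)
qed

lemma separated_labels_homeomorphism:
  assumes h: "homeomorphism X Y h k" and x: "x \<in> X"
    and a: "h a = a'" and b: "\<And>i. i \<in> {1..n} \<Longrightarrow> h (b i) = b' i"
  shows "separated_labels n Y a' b' (h x) \<subseteq> separated_labels n X a b x"
proof
  fix i assume i: "i \<in> separated_labels n Y a' b' (h x)"
  have False if S: "connected S" "S \<subseteq> X - {x}" "a \<in> S" "b i \<in> S" for S
  proof -
    have "continuous_on S h"
      using homeomorphism_cont1[OF h] continuous_on_subset S(2) by blast
    then have "connected (h ` S)" using S(1) by (rule connected_continuous_image)
    moreover have "h y \<noteq> h x" if "y \<in> S" for y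
      using homeomorphism_apply1[OF h x] homeomorphism_apply1[OF h, of y] S(2) that by auto
    moreover have "h y \<in> Y" if "y \<in> S" for y
      using homeomorphism_image1[OF h] S(2) that by blast
    ultimately have "connected (h ` S)" "h ` S \<subseteq> Y - {h x}" by auto
    moreover have "a' \<in> h ` S" unfolding a[symmetric] using S(3) by (rule imageI)
    moreover have "b' i \<in> h ` S"
    proof -
      have "i \<in> {1..n}" using i by (simp add: separated_labels_def)
      from b[OF this, symmetric] show ?thesis using S(4) by simp
    qed
    ultimately show False using i unfolding separated_labels_def by blast
  qed
  then show "i \<in> separated_labels n X a b x" using i unfolding separated_labels_def by blast
qed

lemma separated_labels_image_homeomorphism:
  assumes h: "homeomorphism X Y h k" and "a \<in> X" and "\<And>i. i \<in> {1..n} \<Longrightarrow> b i \<in> X"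
    and a: "h a = a'" and b: "\<And>i. i \<in> {1..n} \<Longrightarrow> h (b i) = b' i"
  shows "separated_labels n X a b ` X = separated_labels n Y a' b' ` Y"
proof -
  have k: "homeomorphism Y X k h" using h by (rule homeomorphism_symD)
  have ka: "k a' = a" using homeomorphism_apply1[OF h assms(2)] a by simp
  have kb: "k (b' i) = b i" if "i \<in> {1..n}" for i
    using homeomorphism_apply1[OF h assms(3)[OF that]] b[OF that] by simp
  have eq: "separated_labels n X a b x = separated_labels n Y a' b' (h x)" if x: "x \<in> X" for x
  proof
    show "separated_labels n Y a' b' (h x) \<subseteq> separated_labels n X a b x"
      by (rule separated_labels_homeomorphism[OF h x a b])
    have hx: "h x \<in> Y" "k (h x) = x"
      using homeomorphism_image1[OF h] homeomorphism_apply1[OF h x] x by auto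
    show "separated_labels n X a b x \<subseteq> separated_labels n Y a' b' (h x)"
      using separated_labels_homeomorphism[OF k hx(1) ka kb] hx(2) by simp
  qed
  have "separated_labels n X a b ` X = separated_labels n Y a' b' ` (h ` X)"
    unfolding image_image by (rule image_cong) (simp_all add: eq)
  then show ?thesis using homeomorphism_image1[OF h] by simp
qed

context cluster_tree
begin

text \<open>The point of the edge from \<open>u\<close> to its parent with weight \<open>t\<close> at the lower end \<open>u\<close>.\<close>

definition edge_point :: "'v \<Rightarrow> real \<Rightarrow> 'v \<Rightarrow> real" where
  "edge_point u t = (\<lambda>w. if w = u then t else if w = parent u then 1 - t else 0)"

lemma edge_point_ends:
  assumes "u \<in> V" "u \<noteq> r"
  shows "edge_point u 1 = vertex_point u" "edge_point u 0 = vertex_point (parent u)"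
  using parent(4)[OF assms] by (auto simp: edge_point_def vertex_point_def indicator_def)

lemma realization_iff:
  "x \<in> realization T \<longleftrightarrow> (\<exists>u\<in>V - {r}. \<exists>t\<in>{0..1}. x = edge_point u t)"
proof
  assume "x \<in> realization T"
  then obtain u where u: "u \<in> V - {r}" "\<And>v. 0 \<le> x v" "\<And>v. v \<notin> {u, parent u} \<Longrightarrow> x v = 0"
    "(\<Sum>v\<in>{u, parent u}. x v) = 1"
    unfolding realization_def edges_parent by auto
  have "u \<noteq> parent u" using parent(4)[of u] u(1) by auto
  then have "x u + x (parent u) = 1" using u(4) by simp
  then have "x (parent u) = 1 - x u" "x u \<in> {0..1}" using u(2)[of u] u(2)[of "parent u"] by auto
  moreover from this(1) have "x = edge_point u (x u)" using u(3) by (auto simp: edge_point_def)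
  ultimately show "\<exists>u\<in>V - {r}. \<exists>t\<in>{0..1}. x = edge_point u t" using u(1) by blast
next
  assume "\<exists>u\<in>V - {r}. \<exists>t\<in>{0..1}. x = edge_point u t"
  then obtain u t where "u \<in> V - {r}" "t \<in> {0..1}" "x = edge_point u t" by (elim bexE)
  then have ut: "u \<in> V - {r}" "0 \<le> t" "t \<le> 1" "x = edge_point u t" by simp_all
  have "parent u \<noteq> u" using parent(4) ut(1) by auto
  then show "x \<in> realization T"
    unfolding realization_def edges_parent using ut
    by (intro CollectI bexI[of _ "{u, parent u}"]) (auto simp: edge_point_def)
qed

lemma edge_point_in: "u \<in> V \<Longrightarrow> u \<noteq> r \<Longrightarrow> 0 \<le> t \<Longrightarrow> t \<le> 1 \<Longrightarrow> edge_point u t \<in> realization T"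
  unfolding realization_iff by (intro bexI[of _ u] bexI[of _ t]) auto

lemma realizationE:
  assumes "x \<in> realization T"
  obtains u t where "u \<in> V" "u \<noteq> r" "0 \<le> t" "t \<le> 1" "x = edge_point u t"
proof -
  obtain u t where "u \<in> V - {r}" "t \<in> {0..1}" "x = edge_point u t"
    using assms unfolding realization_iff by (elim bexE)
  then show ?thesis using that[of u t] by simp
qed

lemma vertex_point_in:
  assumes "v \<in> V" shows "vertex_point v \<in> realization T"
proof (cases "v = r")
  case True
  have "children r \<noteq> {}"
    using many_children[OF root_vertex(1) root_not_singleton] by auto
  then obtain u where u: "u \<in> V" "u \<noteq> r" "parent u = r" by (auto simp: children_def)
  then show ?thesis using edge_point_in[OF u(1,2), of 0] edge_point_ends(2)[OF u(1,2)] True by simp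
next
  case False
  then show ?thesis using edge_point_in[OF assms False, of 1] edge_point_ends(1)[OF assms False] by simp
qed

text \<open>The edges on the way from \<open>v\<close> to the root form a connected set. It avoids the
  given point because \<open>u\<close> is not on this way: otherwise \<open>c v \<subseteq> c u\<close>.\<close>

lemma connected_to_root:
  assumes v: "v \<in> V" and u: "u \<in> V" "u \<noteq> r" "0 < t" "\<not> c v \<subseteq> c u"
  shows "\<exists>S. connected S \<and> S \<subseteq> realization T - {edge_point u t} \<and>
    vertex_point r \<in> S \<and> vertex_point v \<in> S"
  using v u(4)
proof (induction rule: par_induct)
  case root
  have "vertex_point r u \<noteq> edge_point u t u"
    using u by (simp add: vertex_point_def edge_point_def)
  then have "vertex_point r \<noteq> edge_point u t" by metis
  then show ?case
    using vertex_point_in[OF root_vertex(1)] by (intro exI[of _ "{vertex_point r}"]) auto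
next
  case (step v)
  have "c v \<subset> c (parent v)" using parent(3) step by simp
  then have "\<not> c (parent v) \<subseteq> c u" using step(4) by blast
  then obtain S where S: "connected S" "S \<subseteq> realization T - {edge_point u t}"
    "vertex_point r \<in> S" "vertex_point (parent v) \<in> S" using step(3) by blast
  let ?e = "edge_point v ` {0..1}"
  have "continuous_on {0..1} (edge_point v)"
  proof (rule continuous_on_coordinatewise_then_product)
    fix w show "continuous_on {0..1} (\<lambda>t. edge_point v t w)"
      unfolding edge_point_def by (cases "w = v"; cases "w = parent v") (auto intro!: continuous_intros)
  qed
  then have "connected ?e" by (rule connected_continuous_image) simp
  moreover have ends: "vertex_point (parent v) \<in> ?e" "vertex_point v \<in> ?e"
    unfolding edge_point_ends[OF step(1,2), symmetric] by simp_all
  ultimately have "connected (S \<union> ?e)" using S(1,4) by (intro connected_Un) auto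
  moreover have "edge_point v s \<noteq> edge_point u t" for s
  proof -
    have "u \<noteq> v" "u \<noteq> parent v" using step(4) parent(3)[OF step(1,2)] by auto
    then have "edge_point v s u \<noteq> edge_point u t u" using u(3) by (simp add: edge_point_def)
    then show ?thesis by metis
  qed
  then have "S \<union> ?e \<subseteq> realization T - {edge_point u t}"
    using S(2) edge_point_in[OF step(1,2)] by auto
  ultimately show ?case using S(3) ends(2) by (intro exI[of _ "S \<union> ?e"]) auto
qed

text \<open>The weights \<open>a\<close> define a function that is linear on each edge. It is positive below the point
  \<open>edge_point u t\<close>, negative on the rest of the tree, and vanishes exactly at this point. For \<open>t < 1\<close> the weights
  \<open>1 - t\<close> at \<open>u\<close> and \<open>-t\<close> at its parent produce the zero inside the edge, and for \<open>t = 1\<close> the zero is the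
  vertex \<open>u\<close>, so one formula serves for both positions.\<close>

lemma separating_function:
  assumes u: "u \<in> V" "u \<noteq> r" "0 < t" "t \<le> 1"
  defines "a \<equiv> \<lambda>w. if w = u then 1 - t else if c w \<subset> c u then 1 else - t"
  assumes w: "w \<in> V" "w \<noteq> r" "0 \<le> s" "s \<le> 1" "a w * s + a (parent w) * (1 - s) = 0"
  shows "edge_point w s = edge_point u t"
proof -
  have pw: "parent w \<in> V" "c w \<subset> c (parent w)" using parent[OF w(1,2)] by auto
  consider "w = u" | "w \<noteq> u" "c w \<subset> c u" | "w \<noteq> u" "\<not> c w \<subset> c u" by blast
  then show ?thesis
  proof cases
    case 1
    then have "parent w \<noteq> u" "\<not> c (parent w) \<subset> c u" using pw by auto
    then have "s = t" using w(5) 1 by (simp add: a_def algebra_simps)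
    then show ?thesis using 1 by simp
  next
    case 2
    show ?thesis
    proof (cases "parent w = u")
      case True
      then have eq: "s + (1 - t) * (1 - s) = 0" using w(5) 2 by (simp add: a_def)
      moreover have "0 \<le> (1 - t) * (1 - s)" using u w by simp
      ultimately have "s = 0" using w(3) by linarith
      then have "t = 1" using eq by simp
      then show ?thesis using edge_point_ends[OF w(1,2)] edge_point_ends[OF u(1,2)] True \<open>s = 0\<close> by simp
    next
      case False
      have "c (parent w) \<subseteq> c u" using coversD(4)[OF parent(2)[OF w(1,2)] c_mem[OF u(1)] 2(2)] .
      then have "c (parent w) \<subset> c u" using c_inj[OF pw(1) u(1)] False by blast
      then show ?thesis using w(5) 2 False by (simp add: a_def)
    qed
  next
    case 3
    then have "parent w \<noteq> u" "\<not> c (parent w) \<subset> c u" using pw by auto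
    then have "- t * s + - t * (1 - s) = 0" using w(5) 3 by (simp add: a_def)
    then show ?thesis using u(3) by (simp add: algebra_simps)
  qed
qed

text \<open>The separating function takes values of opposite sign at the root and at \<open>v\<close>, so by the
  intermediate value theorem a connected set containing both contains its only zero.\<close>

lemma not_connected_to_root:
  assumes v: "v \<in> V" and u: "u \<in> V" "u \<noteq> r" "0 < t" "t \<le> 1" "c v \<subseteq> c u"
    and S: "connected S" "S \<subseteq> realization T" "vertex_point r \<in> S" "vertex_point v \<in> S"
  shows "edge_point u t \<in> S"
proof -
  define a where "a w = (if w = u then 1 - t else if c w \<subset> c u then 1 else - t)" for w
  \<comment> \<open>as a finite sum of coordinates, \<open>g\<close> is continuous for the product topology\<close>
  define g where "g x = (\<Sum>w\<in>V. a w * x w)" for x :: "'v \<Rightarrow> real"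
  have "continuous_on S g"
    unfolding g_def
    by (intro continuous_on_sum continuous_on_mult continuous_on_const
        continuous_on_product_then_coordinatewise[OF continuous_on_id, unfolded id_def])
  then have con: "connected (g ` S)" using S(1) by (rule connected_continuous_image)
  have g_vertex: "g (vertex_point w) = a w" if "w \<in> V" for w
  proof -
    have "g (vertex_point w) = (\<Sum>w'\<in>V. if w' = w then a w' else 0)"
      unfolding g_def by (intro sum.cong) (auto simp: vertex_point_def)
    then show ?thesis using finite_V that by simp
  qed
  have g_edge: "g (edge_point w s) = a w * s + a (parent w) * (1 - s)" if w: "w \<in> V" "w \<noteq> r" for w s
  proof -
    have "g (edge_point w s) = (\<Sum>x\<in>V. (if x = w then a w * s else 0) + (if x = parent w then a (parent w) * (1 - s) else 0))"
      unfolding g_def using parent(4)[OF w] by (intro sum.cong) (auto simp: edge_point_def)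
    then show ?thesis using finite_V w parent(1)[OF w] by (simp add: sum.distrib)
  qed
  have "\<not> c r \<subset> c u" using root_vertex(2) c_props(1)[OF u(1)] by auto
  then have "g (vertex_point r) = - t" using g_vertex[OF root_vertex(1)] u(2) by (auto simp: a_def)
  moreover have "0 \<le> g (vertex_point v)"
    using g_vertex[OF v] u(4,5) c_inj[OF v u(1)] by (auto simp: a_def)
  moreover have "g (vertex_point r) \<in> g ` S" "g (vertex_point v) \<in> g ` S" using S(3,4) by auto
  ultimately have "0 \<in> g ` S"
    using connectedD_interval[OF con, of "g (vertex_point r)" "g (vertex_point v)" 0] u(3) by simp
  then obtain y where y: "y \<in> S" "g y = 0" by auto
  then obtain w s where ws: "w \<in> V" "w \<noteq> r" "0 \<le> s" "s \<le> 1" "y = edge_point w s"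
    using S(2) realizationE[of y] by blast
  then have "a w * s + a (parent w) * (1 - s) = 0" using y(2) g_edge by simp
  then have "y = edge_point u t"
    using separating_function[OF u(1-4) ws(1-4)] ws(5) unfolding a_def by simp
  then show ?thesis using y(1) by simp
qed

abbreviation "separated \<equiv>
  separated_labels n (realization T) (vertex_point r) (\<lambda>i. vertex_point (leaf T i))"

lemma separated_edge_point:
  assumes "u \<in> V" "u \<noteq> r" "0 < t" "t \<le> 1"
  shows "separated (edge_point u t) = c u"
proof (intro equalityI subsetI)
  fix i assume i: "i \<in> separated (edge_point u t)"
  then have "i \<in> {1..n}" by (simp add: separated_labels_def)
  then have l: "leaf T i \<in> V" "c (leaf T i) = {i}" using leaf by auto
  then show "i \<in> c u"
    using connected_to_root[OF l(1) assms(1-3)] i unfolding separated_labels_def by auto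
next
  fix i assume i: "i \<in> c u"
  then have "i \<in> {1..n}" using c_props(1)[OF assms(1)] by auto
  then have l: "leaf T i \<in> V" "c (leaf T i) = {i}" using leaf by auto
  have "edge_point u t \<in> S" if "connected S" "S \<subseteq> realization T" "vertex_point r \<in> S"
    "vertex_point (leaf T i) \<in> S" for S
    by (rule not_connected_to_root[OF l(1) assms]) (use that i l(2) in auto)
  then show "i \<in> separated (edge_point u t)"
    using \<open>i \<in> {1..n}\<close> unfolding separated_labels_def by blast
qed

lemma separated_root: "separated (vertex_point r) = {1..n}"
  by (rule separated_labels_base)

text \<open>A point of an edge other than its upper end cuts off the cluster of the lower end, and
  the root cuts off everything: the root itself is missing from the complement.\<close>

lemma separated_image: "separated ` realization T = H"
proof (intro equalityI subsetI)
  fix A assume "A \<in> separated ` realization T"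
  then obtain x where x: "x \<in> realization T" "A = separated x" by (elim imageE)
  from x(1) obtain u t where ut: "u \<in> V" "u \<noteq> r" "0 \<le> t" "t \<le> 1" "x = edge_point u t"
    by (rule realizationE)
  have vertex: "separated (vertex_point v) \<in> H" if "v \<in> V" for v
  proof (cases "v = r")
    case True
    then show ?thesis using separated_root root_vertex c_mem by metis
  next
    case False
    then show ?thesis
      using separated_edge_point[OF that False, of 1] edge_point_ends(1)[OF that False] c_mem[OF that]
      by simp
  qed
  show "A \<in> H"
  proof (cases "t = 0")
    case True
    then show ?thesis using vertex[OF parent(1)[OF ut(1,2)]] edge_point_ends(2)[OF ut(1,2)] x(2) ut(5)
      by simp
  next
    case False
    then show ?thesis using separated_edge_point[OF ut(1,2)] ut x(2) c_mem by simp
  qed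
next
  fix A assume "A \<in> H"
  then obtain v where v: "v \<in> V" "c v = A" using c_surj by blast
  have "separated (vertex_point v) = c v"
  proof (cases "v = r")
    case True
    then show ?thesis using separated_root root_vertex(2) by simp
  next
    case False
    then show ?thesis
      using separated_edge_point[OF v(1) False, of 1] edge_point_ends(1)[OF v(1) False] by simp
  qed
  then show "A \<in> separated ` realization T" using vertex_point_in[OF v(1)] v(2) by (metis image_eqI)
qed

end

lemma same_type_imp_clusters_eq:
  assumes "cluster_tree n H T c" "cluster_tree n H' T' c'" and "same_type n T T'"
  shows "H = H'"
proof -
  interpret A: cluster_tree n H T c by fact
  interpret B: cluster_tree n H' T' c' by fact
  obtain h k where h: "homeomorphism (realization T) (realization T') h k"
    "h (vertex_point (root_vertex T)) = vertex_point (root_vertex T')"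
    "\<And>i. i \<in> {1..n} \<Longrightarrow> h (vertex_point (leaf T i)) = vertex_point (leaf T' i)"
    using assms(3) unfolding same_type_def by auto
  have "A.separated ` realization T = B.separated ` realization T'"
    by (rule separated_labels_image_homeomorphism[OF h(1)])
      (simp_all add: h(2,3) A.vertex_point_in A.root_vertex(1) A.leaf(1))
  then show ?thesis using A.separated_image B.separated_image by simp
qed

text \<open>The linear extension of the bijection between the vertices of two trees that matches equal
  clusters, as a map between the ambient spaces of the realizations.\<close>

definition relabel ::
  "'v ltree \<Rightarrow> ('v \<Rightarrow> nat set) \<Rightarrow> 'w ltree \<Rightarrow> ('w \<Rightarrow> nat set) \<Rightarrow> ('v \<Rightarrow> real) \<Rightarrow> 'w \<Rightarrow> real" where
  "relabel T c T' c' x =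
     (\<lambda>w. if w \<in> vertices T' then x (inv_into (vertices T) c (c' w)) else 0)"

lemma relabel_continuous: "continuous_on S (relabel T c T' c')"
proof (rule continuous_on_coordinatewise_then_product)
  fix w show "continuous_on S (\<lambda>x. relabel T c T' c' x w)"
    unfolding relabel_def
    by (cases "w \<in> vertices T'")
      (simp_all add: continuous_on_product_then_coordinatewise[OF continuous_on_id, unfolded id_def])
qed

lemma relabel_tree:
  assumes "cluster_tree n H T c" "cluster_tree n H T' c'"
  defines "\<phi> \<equiv> \<lambda>v. inv_into (vertices T') c' (c v)" and "\<psi> \<equiv> \<lambda>w. inv_into (vertices T) c (c' w)"
  shows "v \<in> vertices T \<Longrightarrow> \<phi> v \<in> vertices T'"
    and "v \<in> vertices T \<Longrightarrow> c' (\<phi> v) = c v"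
    and "v \<in> vertices T \<Longrightarrow> w \<in> vertices T' \<Longrightarrow> \<psi> w = v \<longleftrightarrow> w = \<phi> v"
proof -
  interpret A: cluster_tree n H T c by fact
  interpret B: cluster_tree n H T' c' by fact
  have img: "c ` vertices T = H" "c' ` vertices T' = H" using A.c_bij B.c_bij by (auto simp: bij_betw_def)
  have 1: "\<phi> v \<in> vertices T' \<and> c' (\<phi> v) = c v" if "v \<in> vertices T" for v
    unfolding \<phi>_def using A.c_mem[OF that] img(2) inv_into_into f_inv_into_f by metis
  have 2: "\<psi> w \<in> vertices T \<and> c (\<psi> w) = c' w" if "w \<in> vertices T'" for w
    unfolding \<psi>_def using B.c_mem[OF that] img(1) inv_into_into f_inv_into_f by metis
  show "v \<in> vertices T \<Longrightarrow> \<phi> v \<in> vertices T'" "v \<in> vertices T \<Longrightarrow> c' (\<phi> v) = c v" using 1 by auto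
  show "\<psi> w = v \<longleftrightarrow> w = \<phi> v" if "v \<in> vertices T" "w \<in> vertices T'"
    using 1[OF that(1)] 2[OF that(2)] A.c_inj[OF that(1)] B.c_inj[OF that(2)] that by metis
qed

lemma relabel_vertex_point:
  assumes "cluster_tree n H T c" "cluster_tree n H T' c'" "v \<in> vertices T"
  shows "relabel T c T' c' (vertex_point v) = vertex_point (inv_into (vertices T') c' (c v))"
  using relabel_tree[OF assms(1,2)] assms(3)
  by (auto simp: relabel_def vertex_point_def indicator_def fun_eq_iff)

lemma relabel_edge_point:
  assumes T: "cluster_tree n H T c" and T': "cluster_tree n H T' c'"
    and u: "u \<in> vertices T" "u \<noteq> root_vertex T"
  defines "u' \<equiv> inv_into (vertices T') c' (c u)"
  shows "u' \<in> vertices T'" "u' \<noteq> root_vertex T'" "c' u' = c u"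
    "relabel T c T' c' (cluster_tree.edge_point H T c u t) = cluster_tree.edge_point H T' c' u' t"
proof -
  interpret A: cluster_tree n H T c by fact
  interpret B: cluster_tree n H T' c' by fact
  note rl = relabel_tree[OF T T']
  show u': "u' \<in> vertices T'" "c' u' = c u" using rl(1,2) u(1) unfolding u'_def by auto
  show ur: "u' \<noteq> root_vertex T'" using u' B.root_vertex(2) A.c_root_iff u by metis
  let ?p = "inv_into (vertices T') c' (c (A.parent u))"
  have pu: "A.parent u \<in> vertices T" using A.parent(1) u by simp
  have bp: "B.parent u' = ?p"
    by (rule B.parent_eqI) (use rl(1,2)[OF pu] A.parent(2)[OF u] u' in auto)
  show "relabel T c T' c' (A.edge_point u t) = B.edge_point u' t"
  proof
    fix w
    show "relabel T c T' c' (A.edge_point u t) w = B.edge_point u' t w"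
    proof (cases "w \<in> vertices T'")
      case True
      show ?thesis
        unfolding relabel_def A.edge_point_def B.edge_point_def bp
        by (simp only: rl(3)[OF u(1) True] rl(3)[OF pu True] True if_True u'_def)
    next
      case False
      then have "w \<noteq> u'" "w \<noteq> ?p" using u'(1) rl(1)[OF pu] by auto
      then show ?thesis using False by (simp add: relabel_def B.edge_point_def bp)
    qed
  qed
qed

lemma relabel_inverse:
  assumes T: "cluster_tree n H T c" and T': "cluster_tree n H T' c'" and x: "x \<in> realization T"
  shows "relabel T c T' c' x \<in> realization T'"
    "relabel T' c' T c (relabel T c T' c' x) = x"
proof -
  interpret A: cluster_tree n H T c by fact
  interpret B: cluster_tree n H T' c' by fact
  obtain u t where ut: "u \<in> vertices T" "u \<noteq> root_vertex T" "0 \<le> t" "t \<le> 1" "x = A.edge_point u t"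
    using x by (rule A.realizationE)
  let ?u = "inv_into (vertices T') c' (c u)"
  note rl = relabel_edge_point[OF T T' ut(1,2)]
  have eq: "relabel T c T' c' x = B.edge_point ?u t" using rl(4) ut(5) by simp
  then show "relabel T c T' c' x \<in> realization T'" using B.edge_point_in rl(1,2) ut by simp
  have "inv_into (vertices T) c (c' ?u) = u"
    using rl(3) A.c_bij ut(1) by (simp add: bij_betw_def)
  then show "relabel T' c' T c (relabel T c T' c' x) = x"
    using relabel_edge_point(4)[OF T' T rl(1,2), of t] eq ut(5) by simp
qed

lemma clusters_eq_imp_same_type:
  assumes T: "cluster_tree n H T c" and T': "cluster_tree n H T' c'"
  shows "same_type n T T'"
proof -
  interpret A: cluster_tree n H T c by fact
  interpret B: cluster_tree n H T' c' by fact
  let ?h = "relabel T c T' c'" and ?k = "relabel T' c' T c"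
  note h = relabel_inverse[OF T T'] and k = relabel_inverse[OF T' T]
  have "homeomorphism (realization T) (realization T') ?h ?k"
    by (rule homeomorphismI) (use h k relabel_continuous in auto)
  moreover have "?h (vertex_point v) = vertex_point w"
    if "v \<in> vertices T" "w \<in> vertices T'" "c v = c' w" for v w
  proof -
    have "inv_into (vertices T') c' (c v) = w" using that B.c_bij by (simp add: bij_betw_def)
    then show ?thesis using relabel_vertex_point[OF T T' that(1)] by simp
  qed
  ultimately show ?thesis
    unfolding same_type_def using A.root_vertex B.root_vertex A.leaf B.leaf
    by (intro exI[of _ ?h] exI[of _ ?k]) auto
qed

lemma same_type_iff:
  assumes "cluster_tree n H T c" "cluster_tree n H' T' c'"
  shows "same_type n T T' \<longleftrightarrow> H = H'"
  using same_type_imp_clusters_eq[OF assms] clusters_eq_imp_same_type[OF assms(1)] assms(2) by blast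

text \<open>Every rooted tree has some hierarchy, and trees of the same type have the same one. In this
  form, comparing types involves no topology any more.\<close>

lemma combinatorial_type_eq:
  assumes "cluster_tree n H T c"
  shows "combinatorial_type n T = {S :: nat ltree. \<exists>d. cluster_tree n H S d}"
proof (intro equalityI subsetI)
  fix S :: "nat ltree" assume "S \<in> combinatorial_type n T"
  then have S: "rooted_tree n S" "same_type n T S" unfolding combinatorial_type_def by auto
  obtain G d where d: "cluster_tree n G S d" by (rule cluster_tree_of_rooted_tree[OF S(1)])
  then have "H = G" using same_type_iff[OF assms] S(2) by blast
  then show "S \<in> {S. \<exists>d. cluster_tree n H S d}" using d by blast
next
  fix S :: "nat ltree" assume "S \<in> {S. \<exists>d. cluster_tree n H S d}"
  then obtain d where d: "cluster_tree n H S d" by blast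
  then show "S \<in> combinatorial_type n T"
    unfolding combinatorial_type_def
    using same_type_iff[OF assms d] cluster_tree.rooted_tree[OF d] by simp
qed

section \<open>Contraction of edges\<close>

lemma component_of_iff: "w \<in> component_of F v \<longleftrightarrow> (v, w) \<in> {(x, y). {x, y} \<in> F}\<^sup>*"
  by (simp add: component_of_def)

text \<open>Contraction of the edges from the vertices in \<open>D\<close> to their parents. The proof
  below shows that the contracted tree has the hierarchy \<open>H - c ` D\<close>, and that the cluster of a
  component is the union of the clusters in it, which is the largest of them.\<close>

locale contracted_tree = cluster_tree n H T c
  for n :: nat and H :: "nat set set" and T :: "'v ltree" and c :: "'v \<Rightarrow> nat set" +
  fixes D :: "'v set"
  assumes D: "D \<subseteq> inner"
begin

abbreviation F :: "'v set set" where "F \<equiv> (\<lambda>u. {u, parent u}) ` D"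
abbreviation G :: "nat set set" where "G \<equiv> H - c ` D"
abbreviation linked :: "('v \<times> 'v) set" where "linked \<equiv> {(x, y). {x, y} \<in> F}"

lemma D_mem: "u \<in> D \<Longrightarrow> u \<in> V" "u \<in> D \<Longrightarrow> u \<noteq> r" "u \<in> D \<Longrightarrow> \<not> is_singleton (c u)"
  using D inner_iff by auto

lemma c_in_G: "v \<in> V \<Longrightarrow> c v \<in> G \<longleftrightarrow> v \<notin> D"
  using c_mem c_inj D_mem(1) by auto

lemma hierarchy_G: "hierarchy n G"
proof -
  have "c ` D \<subseteq> proper_clusters n" using D by (auto simp: inner_def)
  then have "trivial_clusters n \<subseteq> G"
    using H trivial_proper_disjoint[of n] unfolding hierarchy_def by auto
  moreover have "laminar G" using laminar_subset[OF hierarchy_laminar[OF H]] by auto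
  ultimately show ?thesis using H unfolding hierarchy_def by auto
qed

text \<open>Ascending from \<open>v\<close> through contracted edges ends at the highest vertex of the component of
  \<open>v\<close>. Its cluster is the least remaining cluster that contains \<open>c v\<close>, because every cluster
  passed on the way is deleted. This description does not mention paths, so it makes
  equality of components easy to test.\<close>

lemma topmost_exists:
  assumes "v \<in> V"
  shows "\<exists>w. w \<in> V - D \<and> (v, w) \<in> linked\<^sup>* \<and> c v \<subseteq> c w \<and> (\<forall>A\<in>G. c v \<subseteq> A \<longrightarrow> c w \<subseteq> A)"
  using assms
proof (induction rule: par_induct)
  case root
  have "r \<notin> D" using D_mem(2) by blast
  then show ?case using root_vertex(1) by (intro exI[of _ r]) simp
next
  case (step v)
  show ?case
  proof (cases "v \<in> D")
    case True
    obtain w where w: "w \<in> V - D" "(parent v, w) \<in> linked\<^sup>*" "c (parent v) \<subseteq> c w"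
      "\<forall>A\<in>G. c (parent v) \<subseteq> A \<longrightarrow> c w \<subseteq> A" using step(3) by blast
    have "(v, parent v) \<in> linked" using True by simp
    then have "(v, w) \<in> linked\<^sup>*" using w(2) by (rule converse_rtrancl_into_rtrancl)
    moreover have "c v \<subseteq> c w" using parent(3)[OF step(1,2)] w(3) by blast
    moreover have "c w \<subseteq> A" if A: "A \<in> G" "c v \<subseteq> A" for A
    proof -
      have "A \<noteq> c v" "A \<in> H" using A True by auto
      then have "c (parent v) \<subseteq> A" using coversD(4)[OF parent(2)[OF step(1,2)]] A(2) by blast
      then show ?thesis using w(4) A(1) by blast
    qed
    ultimately show ?thesis using w(1) by (intro exI[of _ w]) simp
  qed (use step(1) in \<open>intro exI[of _ v], simp\<close>)
qed

definition topmost :: "'v \<Rightarrow> 'v" where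
  "topmost v = (SOME w. w \<in> V - D \<and> (v, w) \<in> linked\<^sup>* \<and> c v \<subseteq> c w \<and>
     (\<forall>A\<in>G. c v \<subseteq> A \<longrightarrow> c w \<subseteq> A))"

lemma topmost:
  assumes "v \<in> V"
  shows "topmost v \<in> V" "topmost v \<notin> D" "(v, topmost v) \<in> linked\<^sup>*" "c v \<subseteq> c (topmost v)"
    "A \<in> G \<Longrightarrow> c v \<subseteq> A \<Longrightarrow> c (topmost v) \<subseteq> A"
  using someI_ex[OF topmost_exists[OF assms]] unfolding topmost_def[symmetric] by auto

lemma topmost_in_G: "v \<in> V \<Longrightarrow> c (topmost v) \<in> G"
  using c_in_G topmost(1,2) by simp

lemma topmost_fixed: "v \<in> V \<Longrightarrow> v \<notin> D \<Longrightarrow> topmost v = v"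
  using topmost(4)[of v] topmost(5)[of v "c v"] c_in_G[of v] topmost(1)[of v] c_inj[of "topmost v" v] by simp

lemma topmost_parent:
  assumes "u \<in> D" shows "topmost (parent u) = topmost u"
proof -
  have u: "u \<in> V" "u \<noteq> r" using D_mem assms by auto
  have p: "parent u \<in> V" "c u \<subset> c (parent u)" using parent[OF u] by auto
  have "c u \<subset> c (topmost u)" using topmost(1,2,4)[OF u(1)] c_inj[OF u(1) topmost(1)[OF u(1)]] assms by auto
  then have "c (parent u) \<subseteq> c (topmost u)"
    by (rule coversD(4)[OF parent(2)[OF u] c_mem[OF topmost(1)[OF u(1)]]])
  then have "c (topmost (parent u)) \<subseteq> c (topmost u)" by (rule topmost(5)[OF p(1) topmost_in_G[OF u(1)]])
  moreover have "c u \<subseteq> c (topmost (parent u))" using topmost(4)[OF p(1)] p(2) by blast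
  then have "c (topmost u) \<subseteq> c (topmost (parent u))" by (rule topmost(5)[OF u(1) topmost_in_G[OF p(1)]])
  ultimately show ?thesis using c_inj[OF topmost(1)[OF p(1)] topmost(1)[OF u(1)]] by blast
qed

lemma topmost_linked:
  assumes "(v, w) \<in> linked\<^sup>*" "v \<in> V" shows "w \<in> V \<and> topmost w = topmost v"
  using assms
proof (induction rule: rtrancl_induct)
  case (step x y)
  then obtain u where u: "u \<in> D" "{x, y} = {u, parent u}" by auto
  then have "x = u \<and> y = parent u \<or> x = parent u \<and> y = u" by (simp add: doubleton_eq_iff)
  then show ?case using step topmost_parent[OF u(1)] parent(1)[of u] D_mem[OF u(1)] by auto
qed simp

lemma component: "v \<in> V \<Longrightarrow> component_of F v = {w \<in> V. topmost w = topmost v}"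
proof (intro equalityI subsetI)
  assume v: "v \<in> V"
  fix w assume "w \<in> component_of F v"
  then have "(v, w) \<in> linked\<^sup>*" by (simp only: component_of_iff)
  from topmost_linked[OF this v] show "w \<in> {w \<in> V. topmost w = topmost v}" by blast
next
  assume v: "v \<in> V"
  fix w assume "w \<in> {w \<in> V. topmost w = topmost v}"
  then have w: "w \<in> V" "topmost w = topmost v" by auto
  have "sym linked" by (auto simp: sym_def insert_commute)
  have "(topmost v, w) \<in> linked\<^sup>*"
    using symD[OF sym_rtrancl[OF \<open>sym linked\<close>] topmost(3)[OF w(1)]] w(2) by simp
  with topmost(3)[OF v] have "(v, w) \<in> linked\<^sup>*" by (rule rtrancl_trans)
  then show "w \<in> component_of F v" by (simp only: component_of_iff)
qed

lemma component_eq_iff: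
  assumes "v \<in> V" "w \<in> V"
  shows "component_of F v = component_of F w \<longleftrightarrow> topmost v = topmost w"
  using component[OF assms(1)] component[OF assms(2)] assms by auto

lemma component_cluster: "v \<in> V \<Longrightarrow> \<Union>(c ` component_of F v) = c (topmost v)"
proof (intro equalityI)
  assume v: "v \<in> V"
  have "c w \<subseteq> c (topmost v)" if "w \<in> component_of F v" for w
    using that topmost(4)[of w] component[OF v] by auto
  then show "\<Union>(c ` component_of F v) \<subseteq> c (topmost v)" by blast
  have "topmost v \<in> component_of F v"
    using component[OF v] topmost(1,2)[OF v] topmost_fixed[of "topmost v"] by simp
  then show "c (topmost v) \<subseteq> \<Union>(c ` component_of F v)" by blast
qed

lemma covers_top_parent:
  assumes u: "u \<in> V" "u \<noteq> r" "u \<notin> D"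
  shows "covers G (c u) (c (topmost (parent u)))"
proof -
  have p: "parent u \<in> V" "c u \<subset> c (parent u)" using parent[OF u(1,2)] by auto
  have "c (topmost (parent u)) \<subseteq> A" if A: "A \<in> G" "c u \<subset> A" for A
  proof -
    have "c (parent u) \<subseteq> A" using coversD(4)[OF parent(2)[OF u(1,2)] _ A(2)] A(1) by blast
    then show ?thesis by (rule topmost(5)[OF p(1) A(1)])
  qed
  moreover have "c u \<in> G" using u c_in_G by blast
  moreover have "c u \<subset> c (topmost (parent u))" using p topmost(4)[OF p(1)] by blast
  ultimately show ?thesis unfolding covers_def using topmost_in_G[OF p(1)] by blast
qed

lemma uncontracted_edges: "edges T - F = (\<lambda>u. {u, parent u}) ` (V - {r} - D)"
proof -
  have "inj_on (\<lambda>u. {u, parent u}) (V - {r})" using par_edge_inj by (intro inj_onI)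
  moreover have "D \<subseteq> V - {r}" using D_mem by blast
  ultimately show ?thesis unfolding edges_parent by (simp add: inj_on_image_set_diff)
qed

lemma cluster_tree_contract: "cluster_tree n G (contract T F) (\<lambda>X. \<Union>(c ` X))"
proof
  let ?C = "component_of F" and ?T = "contract T F"
  have verts: "vertices ?T = ?C ` V" by (simp add: contract_def)
  show "hierarchy n G" by (rule hierarchy_G)
  show "bij_betw (\<lambda>X. \<Union>(c ` X)) (vertices ?T) G"
    unfolding bij_betw_def
  proof
    show "inj_on (\<lambda>X. \<Union>(c ` X)) (vertices ?T)"
    proof (rule inj_onI)
      fix X Y assume XY: "X \<in> vertices ?T" "Y \<in> vertices ?T" "\<Union>(c ` X) = \<Union>(c ` Y)"
      then obtain v w where vw: "v \<in> V" "X = ?C v" "w \<in> V" "Y = ?C w" unfolding verts by blast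
      then have "c (topmost v) = c (topmost w)" using XY(3) component_cluster by metis
      then have "topmost v = topmost w" using c_inj topmost(1) vw by simp
      then show "X = Y" using component_eq_iff vw by simp
    qed
    show "(\<lambda>X. \<Union>(c ` X)) ` vertices ?T = G"
    proof (intro equalityI subsetI)
      fix A assume "A \<in> (\<lambda>X. \<Union>(c ` X)) ` vertices ?T"
      then obtain v where v: "v \<in> V" "A = \<Union>(c ` ?C v)" unfolding verts by auto
      show "A \<in> G" using topmost_in_G[OF v(1)] unfolding v(2) component_cluster[OF v(1)] .
    next
      fix A assume A: "A \<in> G"
      then obtain v where v: "v \<in> V" "c v = A" using c_surj by blast
      then have "topmost v = v" using topmost_fixed c_in_G A by blast
      then have "\<Union>(c ` ?C v) = A" using component_cluster[OF v(1)] v(2) by simp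
      then show "A \<in> (\<lambda>X. \<Union>(c ` X)) ` vertices ?T" unfolding verts using v(1) by blast
    qed
  qed
  show "edges ?T = {{X, Y} | X Y. X \<in> vertices ?T \<and> Y \<in> vertices ?T \<and>
      covers G (\<Union>(c ` X)) (\<Union>(c ` Y))}" (is "_ = ?R")
  proof (intro equalityI subsetI)
    fix e assume "e \<in> edges ?T"
    then have "e \<in> (\<lambda>e. ?C ` e) ` (edges T - F)" by (simp add: contract_def)
    then obtain u where u: "u \<in> V" "u \<noteq> r" "u \<notin> D" "e = ?C ` {u, parent u}"
      unfolding uncontracted_edges by blast
    have p: "parent u \<in> V" using parent[OF u(1,2)] by simp
    have "covers G (\<Union>(c ` ?C u)) (\<Union>(c ` ?C (parent u)))"
      unfolding component_cluster[OF u(1)] component_cluster[OF p] topmost_fixed[OF u(1,3)]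
      by (rule covers_top_parent[OF u(1-3)])
    then show "e \<in> ?R" unfolding verts using u p
      by (intro CollectI exI[of _ "?C u"] exI[of _ "?C (parent u)"]) simp
  next
    fix e assume "e \<in> ?R"
    then obtain v w where vw: "v \<in> V" "w \<in> V" "e = {?C v, ?C w}"
      "covers G (\<Union>(c ` ?C v)) (\<Union>(c ` ?C w))" unfolding verts by blast
    let ?u = "topmost v"
    have cov: "covers G (c ?u) (c (topmost w))" using vw(4) component_cluster vw by simp
    have u: "?u \<in> V" "?u \<notin> D" using topmost vw(1) by auto
    have "?u \<noteq> r"
    proof
      assume "?u = r"
      then have "{1..n} \<subset> c (topmost w)" using coversD(3)[OF cov] root_vertex(2) by simp
      then show False using c_props(1)[OF topmost(1)[OF vw(2)]] by blast
    qed
    have p: "parent ?u \<in> V" using parent u \<open>?u \<noteq> r\<close> by blast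
    have "c (topmost (parent ?u)) = c (topmost w)"
      using covers_unique[OF covers_top_parent[OF u(1) \<open>?u \<noteq> r\<close> u(2)] cov] .
    then have "?C (parent ?u) = ?C w"
      using c_inj[OF topmost(1)[OF p] topmost(1)[OF vw(2)]] component_eq_iff[OF p vw(2)] by simp
    moreover have "?C ?u = ?C v"
      using component_eq_iff[OF u(1) vw(1)] topmost_fixed[OF u] by simp
    ultimately have "e = ?C ` {?u, parent ?u}" using vw(3) by simp
    then have "e \<in> (\<lambda>e. ?C ` e) ` (edges T - F)"
      unfolding uncontracted_edges using u \<open>?u \<noteq> r\<close> by blast
    then show "e \<in> edges ?T" by (simp add: contract_def)
  qed
  have root_D: "r \<notin> D" using D_mem(2) by blast
  show "root_vertex ?T \<in> vertices ?T" using root_vertex(1) by (simp add: contract_def)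
  show "\<Union>(c ` root_vertex ?T) = {1..n}"
    using component_cluster[OF root_vertex(1)] topmost_fixed[OF root_vertex(1) root_D] root_vertex(2)
    by (simp add: contract_def)
  fix i assume i: "i \<in> {1..n}"
  show "leaf ?T i \<in> vertices ?T" using leaf(1)[OF i] by (simp add: contract_def)
  have "leaf T i \<notin> D" using D_mem(3)[of "leaf T i"] leaf(2)[OF i] by auto
  then show "\<Union>(c ` leaf ?T i) = {i}"
    using component_cluster[OF leaf(1)[OF i]] topmost_fixed[OF leaf(1)[OF i]] leaf(2)[OF i]
    by (simp add: contract_def)
qed

end

context cluster_tree
begin

lemma c_inner: "c ` inner = H \<inter> proper_clusters n"
  unfolding inner_def using c_mem c_surj by auto

lemma contract_clusters:
  assumes "D \<subseteq> inner"
  shows "cluster_tree n (H - c ` D) (contract T ((\<lambda>u. {u, parent u}) ` D)) (\<lambda>X. \<Union>(c ` X))"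
proof -
  interpret contracted_tree n H T c D by unfold_locales (rule assms)
  show ?thesis by (rule cluster_tree_contract)
qed

lemma contract_all_but_one:
  assumes u: "u \<in> inner"
  shows "cluster_tree n (insert (c u) (trivial_clusters n))
    (contract T (internal_edges T - {{u, parent u}})) (\<lambda>X. \<Union>(c ` X))"
proof -
  have "internal_edges T - {{u, parent u}} = (\<lambda>u. {u, parent u}) ` (inner - {u})"
    unfolding internal_edges using par_edge_inj u inner_iff by fastforce
  moreover have "H - c ` (inner - {u}) = insert (c u) (trivial_clusters n)"
  proof -
    have "c ` (inner - {u}) = H \<inter> proper_clusters n - {c u}"
      unfolding c_inner[symmetric] using u c_inj by (auto simp: inner_def)
    moreover have "c u \<in> H" using u c_mem by (simp add: inner_def)
    ultimately show ?thesis
      using hierarchy_split[OF H] trivial_proper_disjoint[of n] by blast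
  qed
  ultimately show ?thesis using contract_clusters[of "inner - {u}"] by auto
qed

end

section \<open>Simplices of the complex of trees\<close>

text \<open>The combinatorial type of the tree with \<open>C\<close> as its only proper cluster, written as
  in \<open>combinatorial_type_eq\<close>.\<close>

definition cluster_type :: "nat \<Rightarrow> nat set \<Rightarrow> nat ltree set" where
  "cluster_type n C = {S. \<exists>d. cluster_tree n (insert C (trivial_clusters n)) S d}"

lemma tree_simplex_eq:
  assumes "cluster_tree n H T c"
  shows "tree_simplex n T = cluster_type n ` (H \<inter> proper_clusters n)"
proof -
  interpret cluster_tree n H T c by fact
  have "combinatorial_type n (contract T (internal_edges T - {{u, parent u}})) = cluster_type n (c u)"
    if "u \<in> inner" for u
    unfolding cluster_type_def by (rule combinatorial_type_eq[OF contract_all_but_one[OF that]])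
  then have "(\<lambda>e. combinatorial_type n (contract T (internal_edges T - {e}))) ` internal_edges T =
      (\<lambda>u. cluster_type n (c u)) ` inner"
    unfolding internal_edges image_image by (intro image_cong) simp_all
  moreover have "tree_simplex n T =
      (\<lambda>e. combinatorial_type n (contract T (internal_edges T - {e}))) ` internal_edges T"
    unfolding tree_simplex_def by auto
  ultimately show ?thesis unfolding c_inner[symmetric] image_image by simp
qed

lemma inj_cluster_type:
  assumes "2 \<le> n" shows "inj_on (cluster_type n) (proper_clusters n)"
proof (rule inj_onI)
  fix A B assume AB: "A \<in> proper_clusters n" "B \<in> proper_clusters n" "cluster_type n A = cluster_type n B"
  have "hierarchy n (trivial_clusters n \<union> {A})"
    using assms AB(1) by (intro hierarchy_of_laminar) (auto simp: laminar_def)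
  then have hier: "hierarchy n (insert A (trivial_clusters n))" by simp
  let ?S = "encoded_tree n (insert A (trivial_clusters n))"
  have S: "cluster_tree n (insert A (trivial_clusters n)) ?S set_decode"
    by (rule cluster_tree_encoded[OF hier])
  then have "?S \<in> cluster_type n A" unfolding cluster_type_def by blast
  then have "?S \<in> cluster_type n B" using AB(3) by simp
  then obtain d where d: "cluster_tree n (insert B (trivial_clusters n)) ?S d"
    unfolding cluster_type_def by blast
  have "same_type n ?S ?S" using same_type_iff[OF S S] by simp
  then have "insert A (trivial_clusters n) = insert B (trivial_clusters n)"
    using same_type_iff[OF S d] by simp
  then show "A = B" using AB(1,2) trivial_proper_disjoint[of n] by blast
qed

text \<open>A contraction of a binary tree yields a laminar family. Conversely, a nonempty laminar
  family \<open>N\<close> is refined to a binary hierarchy, and the clusters outside of \<open>N\<close> are contracted; the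
  number of contracted edges is at most \<open>(n - 2) - 1\<close>, as \<open>N\<close> keeps at least one proper cluster. The empty
  family corresponds to the empty simplex.\<close>

lemma complex_of_trees_eq:
  assumes "3 \<le> n"
  shows "complex_of_trees n = {cluster_type n ` N | N. N \<subseteq> proper_clusters n \<and> laminar N}"
proof (intro equalityI subsetI)
  fix \<sigma> assume "\<sigma> \<in> complex_of_trees n"
  then consider "\<sigma> = {}" | T F where "\<sigma> = tree_simplex n (contract T F)" "binary_tree n (T :: nat ltree)"
      "F \<subseteq> internal_edges T"
    unfolding complex_of_trees_def by auto
  then show "\<sigma> \<in> {cluster_type n ` N | N. N \<subseteq> proper_clusters n \<and> laminar N}"
  proof cases
    case 1
    then show ?thesis by (intro CollectI exI[of _ "{}"]) (simp add: laminar_def)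
  next
    case (2 T F)
    obtain H c where "cluster_tree n H T c"
      using cluster_tree_of_rooted_tree 2(2) unfolding binary_tree_def by metis
    then interpret cluster_tree n H T c .
    obtain D where D: "D \<subseteq> inner" "F = (\<lambda>u. {u, parent u}) ` D"
      using 2(3) unfolding internal_edges by (elim subset_imageE)
    note G = contract_clusters[OF D(1), folded D(2)]
    let ?N = "(H - c ` D) \<inter> proper_clusters n"
    have "laminar ?N" using laminar_subset[OF hierarchy_laminar[OF H], of ?N] by blast
    then show ?thesis using tree_simplex_eq[OF G] 2(1) by blast
  qed
next
  fix \<sigma> assume "\<sigma> \<in> {cluster_type n ` N | N. N \<subseteq> proper_clusters n \<and> laminar N}"
  then obtain N where N: "\<sigma> = cluster_type n ` N" "N \<subseteq> proper_clusters n" "laminar N" by auto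
  show "\<sigma> \<in> complex_of_trees n"
  proof (cases "N = {}")
    case True
    then show ?thesis using N(1) by (simp add: complex_of_trees_def)
  next
    case False
    have "2 \<le> n" using assms by simp
    then obtain H where hier: "hierarchy n H" "N \<subseteq> H" "binary_hierarchy H"
      using N(2,3) by (rule binary_refinement)
    let ?T = "encoded_tree n H"
    interpret cluster_tree n H ?T set_decode by (rule cluster_tree_encoded[OF hier(1)])
    \<comment> \<open>contract exactly the edges above the vertices whose clusters are not in \<open>N\<close>\<close>
    define D where "D = {u \<in> inner. set_decode u \<notin> N}"
    have D: "D \<subseteq> inner" by (auto simp: D_def)
    let ?F = "(\<lambda>u. {u, parent u}) ` D"
    have cD: "set_decode ` D = H \<inter> proper_clusters n - N"
      unfolding c_inner[symmetric] D_def by auto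
    have "(H - set_decode ` D) \<inter> proper_clusters n = N" unfolding cD using N(2) hier(2) by blast
    then have "tree_simplex n (contract ?T ?F) = \<sigma>"
      using tree_simplex_eq[OF contract_clusters[OF D]] N(1) by simp
    moreover have "?F \<subseteq> internal_edges ?T" unfolding internal_edges using D by blast
    moreover have "card ?F \<le> n - 3"
    proof -
      have fin: "finite (H \<inter> proper_clusters n)" "finite N" "finite D"
        using hierarchy_finite[OF hier(1)] hier(2) finite_subset D finite_V inner_def
        by (auto intro: finite_subset)
      have "D \<subseteq> V" using D by (auto simp: inner_def)
      then have "inj_on set_decode D" by (rule inj_on_subset[OF bij_betw_imp_inj_on[OF c_bij]])
      then have "card ?F \<le> card (H \<inter> proper_clusters n - N)"
        using card_image_le[OF fin(3)] card_image cD by metis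
      also have "\<dots> = card (H \<inter> proper_clusters n) - card N"
        using hier(2) N(2) by (intro card_Diff_subset fin) blast
      also have "\<dots> \<le> n - 2 - 1"
      proof -
        have "1 \<le> card N" using False fin(2) by (simp add: Suc_le_eq card_gt_0_iff)
        then show ?thesis using hierarchy_card_le[OF hier(1)] by linarith
      qed
      finally show ?thesis by simp
    qed
    ultimately show ?thesis
      unfolding complex_of_trees_def using binary_tree[OF hier(3)] by blast
  qed
qed

section \<open>Irreducible elements and nested sets of the partition lattice\<close>

lemma partial_orderI:
  assumes "eq L = (=)"
    and "\<And>x. x \<in> carrier L \<Longrightarrow> x \<sqsubseteq>\<^bsub>L\<^esub> x"
    and "\<And>x y. x \<in> carrier L \<Longrightarrow> y \<in> carrier L \<Longrightarrow> x \<sqsubseteq>\<^bsub>L\<^esub> y \<Longrightarrow> y \<sqsubseteq>\<^bsub>L\<^esub> x \<Longrightarrow> x = y"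
    and "\<And>x y z. x \<in> carrier L \<Longrightarrow> y \<in> carrier L \<Longrightarrow> z \<in> carrier L \<Longrightarrow>
      x \<sqsubseteq>\<^bsub>L\<^esub> y \<Longrightarrow> y \<sqsubseteq>\<^bsub>L\<^esub> z \<Longrightarrow> x \<sqsubseteq>\<^bsub>L\<^esub> z"
  shows "partial_order L"
proof
  show "x \<sqsubseteq>\<^bsub>L\<^esub> z" if "x \<sqsubseteq>\<^bsub>L\<^esub> y" "y \<sqsubseteq>\<^bsub>L\<^esub> z" "x \<in> carrier L" "y \<in> carrier L" "z \<in> carrier L" for x y z
    using assms(4)[OF that(3-5,1,2)] .
qed (use assms(1-3) in simp_all)

lemma (in partial_order) sup_eqI: "least L x (Upper L A) \<Longrightarrow> \<Squnion>\<^bsub>L\<^esub> A = x"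
  unfolding sup_def by (rule some_equality[OF _ least_unique])

text \<open>The partition lattice over an arbitrary set, so that the intervals below its elements
  are composed of objects of the same kind.\<close>

definition partition_order :: "'a set \<Rightarrow> 'a set set gorder" where
  "partition_order A = \<lparr>carrier = {P. partition_on A P}, eq = (=), le = refines A\<rparr>"

lemma partition_order_simps [simp]:
  "carrier (partition_order A) = {P. partition_on A P}"
  "le (partition_order A) = refines A" "eq (partition_order A) = (=)"
  by (simp_all add: partition_order_def)

lemma partial_order_partition_order: "partial_order (partition_order A)"
proof (rule partial_orderI)
  show "P = Q" if "P \<sqsubseteq>\<^bsub>partition_order A\<^esub> Q" "Q \<sqsubseteq>\<^bsub>partition_order A\<^esub> P" for P Q
    using that by (intro refines_asym) simp_all
qed (auto intro: refines_refl refines_trans)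

definition singletons :: "'a set \<Rightarrow> 'a set set" where
  "singletons A = (\<lambda>x. {x}) ` A"

definition one_block :: "'a set \<Rightarrow> 'a set \<Rightarrow> 'a set set" where
  "one_block A C = insert C (singletons (A - C))"

lemma partition_on_singletons': "partition_on A (singletons A)"
  unfolding singletons_def by (rule partition_on_singletons)

lemma partition_on_blocks_singletons:
  assumes "\<And>C. C \<in> M \<Longrightarrow> C \<subseteq> A \<and> C \<noteq> {}" "pairwise disjnt M"
  shows "partition_on A (M \<union> singletons (A - \<Union>M))"
proof (rule partition_onI)
  show "\<Union>(M \<union> singletons (A - \<Union>M)) = A" using assms(1) by (auto simp: singletons_def)
  show "{} \<notin> M \<union> singletons (A - \<Union>M)" using assms(1) by (auto simp: singletons_def)
  fix p q assume "p \<in> M \<union> singletons (A - \<Union>M)" "q \<in> M \<union> singletons (A - \<Union>M)" "p \<noteq> q"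
  then show "disjnt p q"
    using assms(2) by (auto simp: singletons_def pairwise_def disjnt_iff)
qed

lemma partition_on_one_block: "C \<subseteq> A \<Longrightarrow> C \<noteq> {} \<Longrightarrow> partition_on A (one_block A C)"
  using partition_on_blocks_singletons[of "{C}" A] by (simp add: one_block_def)

lemma block_unique:
  assumes "partition_on A P" "B \<in> P" "C \<in> P" "x \<in> B" "x \<in> C" shows "B = C"
  using assms unfolding partition_on_def pairwise_def disjnt_iff by blast

lemma refines_blocks_singletons:
  assumes "partition_on A (M \<union> singletons (A - \<Union>M))" "partition_on A P"
  shows "refines A (M \<union> singletons (A - \<Union>M)) P \<longleftrightarrow> (\<forall>C\<in>M. \<exists>B\<in>P. C \<subseteq> B)"
proof -
  have "\<exists>B\<in>P. X \<subseteq> B" if "X \<in> singletons (A - \<Union>M)" for X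
  proof -
    obtain x where "x \<in> A" "X = {x}" using \<open>X \<in> _\<close> by (auto simp: singletons_def)
    then show ?thesis using partition_onD1[OF assms(2)] by blast
  qed
  then show ?thesis using assms unfolding refines_def by blast
qed

lemma refines_one_block:
  assumes "C \<subseteq> A" "C \<noteq> {}" "partition_on A P"
  shows "refines A (one_block A C) P \<longleftrightarrow> (\<exists>B\<in>P. C \<subseteq> B)"
  using refines_blocks_singletons[of A "{C}" P] partition_on_one_block[OF assms(1,2)] assms(3)
  by (simp add: one_block_def)

lemma refines_singletons: "partition_on A P \<Longrightarrow> refines A (singletons A) P"
  using refines_blocks_singletons[of A "{}" P] partition_on_singletons'[of A] by simp

lemma refines_one_block_iff:
  assumes "C \<subseteq> A" "D \<subseteq> A" "D \<noteq> {}" "2 \<le> card C"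
  shows "refines A (one_block A C) (one_block A D) \<longleftrightarrow> C \<subseteq> D"
proof -
  have "C \<noteq> {}" "\<not> C \<subseteq> {x}" for x using assms(4) card_mono[of "{x}" C] by auto
  then show ?thesis
    using refines_one_block[OF assms(1) _ partition_on_one_block[OF assms(2,3)]]
    by (auto simp: one_block_def singletons_def)
qed

lemma one_block_big: "X \<in> one_block A C \<Longrightarrow> 2 \<le> card X \<Longrightarrow> X = C"
  by (auto simp: one_block_def singletons_def)

lemma not_singletons: "C \<in> Y \<Longrightarrow> 2 \<le> card C \<Longrightarrow> Y \<noteq> singletons S"
  by (auto simp: singletons_def)

lemma inj_one_block: "inj_on (one_block A) {C. C \<subseteq> A \<and> 2 \<le> card C}"
  by (rule inj_onI) (metis (mono_tags, lifting) insertI1 mem_Collect_eq one_block_big one_block_def)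

lemma bottom_partition_order: "\<bottom>\<^bsub>partition_order A\<^esub> = singletons A"
proof -
  interpret partial_order "partition_order A" by (rule partial_order_partition_order)
  have l: "least (partition_order A) (singletons A) (carrier (partition_order A))"
    using refines_singletons[of A] partition_on_singletons'[of A] by (auto simp: least_def)
  show ?thesis unfolding bottom_def 
    by (rule some_equality[where P = "\<lambda>x. least (partition_order A) x (carrier (partition_order A))", OF l]) (rule least_unique[OF _ l])
qed

lemma top_partition_order:
  assumes "A \<noteq> {}" shows "\<top>\<^bsub>partition_order A\<^esub> = one_block A A"
proof -
  interpret partial_order "partition_order A" by (rule partial_order_partition_order)
  have top: "partition_on A (one_block A A)" using assms by (intro partition_on_one_block) auto
  moreover have "refines A P (one_block A A)" if "partition_on A P" for P
    using that top partition_onD1[OF that] unfolding refines_def by (auto simp: one_block_def)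
  ultimately have g: "greatest (partition_order A) (one_block A A) (carrier (partition_order A))"
    by (auto simp: greatest_def)
  show ?thesis unfolding top_def 
    by (rule some_equality[where P = "\<lambda>x. greatest (partition_order A) x (carrier (partition_order A))", OF g]) (rule greatest_unique[OF _ g])
qed

lemma lower_interval_partition_order:
  assumes "partition_on A X"
  shows "carrier (lower_interval (partition_order A) X) = {P. refines A P X}"
    "le (lower_interval (partition_order A) X) = refines A"
  unfolding lower_interval_def at_least_at_most_def bottom_partition_order
  using refines_singletons by (auto simp: refines_def)

text \<open>Unless \<open>x\<close> and \<open>y\<close> share a block of \<open>W\<close>, every block of \<open>W\<close> is a singleton. So the
  partitions with a pair as their only big block are atoms.\<close>

lemma refines_pair_cases:
  assumes "refines A W (one_block A {x, y})" "x \<in> A" "y \<in> A"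
  shows "W = singletons A \<or> W = one_block A {x, y}"
proof (cases "\<exists>B\<in>W. {x, y} \<subseteq> B")
  case True
  then have "refines A (one_block A {x, y}) W"
    using assms refines_one_block[of "{x, y}" A W] by (auto simp: refines_def)
  then show ?thesis using refines_asym[OF assms(1)] by simp
next
  case False
  have W: "partition_on A W" using assms(1) by (simp add: refines_def)
  have "refines A W (singletons A)"
    unfolding refines_def
  proof (intro conjI ballI W partition_on_singletons')
    fix B assume B: "B \<in> W"
    then obtain Y where Y: "Y \<in> one_block A {x, y}" "B \<subseteq> Y" using assms(1) by (auto simp: refines_def)
    have "\<exists>z\<in>A. B \<subseteq> {z}"
    proof (cases "Y = {x, y}")
      case True
      then have "B \<subseteq> {x} \<or> B \<subseteq> {y}" using Y(2) False B by auto
      then show ?thesis using assms(2,3) by auto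
    next
      case False
      then show ?thesis using Y by (auto simp: one_block_def singletons_def)
    qed
    then show "\<exists>Y\<in>singletons A. B \<subseteq> Y" by (auto simp: singletons_def)
  qed
  then show ?thesis using refines_asym refines_singletons[OF W] by blast
qed

text \<open>Colour the pair \<open>x, y\<close> by a partition that has a block containing both. If \<open>x\<close> and
  \<open>y\<close> are not in a common block of \<open>Z\<close>, no \<open>w\<close> can be in a common block of \<open>Z\<close> with both of
  them, so each \<open>w\<close> is joined by \<open>Z'\<close> to one of them, and then to both.\<close>

lemma block_of_two_partitions:
  assumes "partition_on A Z" "partition_on A Z'" "C \<subseteq> A" "C \<noteq> {}"
    and pairs: "\<And>x y. x \<in> C \<Longrightarrow> y \<in> C \<Longrightarrow> x \<noteq> y \<Longrightarrow> (\<exists>B\<in>Z. {x, y} \<subseteq> B) \<or> (\<exists>B\<in>Z'. {x, y} \<subseteq> B)"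
  shows "(\<exists>B\<in>Z. C \<subseteq> B) \<or> (\<exists>B\<in>Z'. C \<subseteq> B)"
proof (rule ccontr)
  assume contra: "\<not> ?thesis"
  obtain x where x: "x \<in> C" using assms(4) by blast
  obtain B where B: "B \<in> Z" "x \<in> B" using partition_onD1[OF assms(1)] x assms(3) by blast
  then obtain y where y: "y \<in> C" "y \<notin> B" using contra by blast
  have no_B: "\<not> (\<exists>D\<in>Z. {w, y} \<subseteq> D)" if "w \<in> B" for w
    using block_unique[OF assms(1) B(1) _ that] y(2) by auto
  then obtain B' where B': "B' \<in> Z'" "{x, y} \<subseteq> B'" using pairs[OF x y(1)] B(2) y(2) by blast
  have "w \<in> B'" if w: "w \<in> C" for w
  proof (cases "w = x \<or> w = y")
    case False
    show ?thesis
    proof (cases "w \<in> B")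
      case True
      then obtain D where D: "D \<in> Z'" "{w, y} \<subseteq> D" using pairs[OF w y(1)] no_B False by blast
      then have "D = B'" using block_unique[OF assms(2) D(1) B'(1), of y] B'(2) by simp
      then show ?thesis using D(2) by simp
    next
      case nB: False
      have "\<not> (\<exists>D\<in>Z. {w, x} \<subseteq> D)" using block_unique[OF assms(1) B(1) _ B(2)] nB by auto
      then obtain D where D: "D \<in> Z'" "{w, x} \<subseteq> D" using pairs[OF w x] False by blast
      then have "D = B'" using block_unique[OF assms(2) D(1) B'(1), of x] B'(2) by simp
      then show ?thesis using D(2) by simp
    qed
  qed (use B'(2) in auto)
  then show False using contra B'(1) by blast
qed

text \<open>In a product with bottom \<open>(p0, q0)\<close> and top \<open>(p1, q1)\<close>, every atom is below \<open>(p1, q0)\<close> or below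
  \<open>(p0, q1)\<close>. The atoms below a partition with the single big block \<open>C\<close> are the pairs in \<open>C\<close>, so the
  two partitions that correspond to these elements join all pairs in \<open>C\<close>. Then one of them equals
  the top, and the other factor is trivial.\<close>

lemma one_block_not_decomposable:
  assumes C: "C \<subseteq> A" "2 \<le> card C"
  shows "\<not> decomposable (partition_order A) (one_block A C)"
proof
  have Cne: "C \<noteq> {}" using C(2) by auto
  let ?X = "one_block A C"
  have X: "partition_on A ?X" by (rule partition_on_one_block[OF C(1) Cne])
  note int = lower_interval_partition_order[OF X]
  assume "decomposable (partition_order A) ?X"
  then obtain P Q \<phi> where PQ: "partial_order (P :: 'a set set gorder)" "partial_order (Q :: 'a set set gorder)"
    "1 < card (carrier P)" "1 < card (carrier Q)"
    "order_isomorphism (product_order P Q) (lower_interval (partition_order A) ?X) \<phi>"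
    unfolding decomposable_def by blast
  interpret P: partial_order P by fact
  interpret Q: partial_order Q by fact
  have emb: "refines A (\<phi> (p, q)) (\<phi> (p', q')) \<longleftrightarrow> p \<sqsubseteq>\<^bsub>P\<^esub> p' \<and> q \<sqsubseteq>\<^bsub>Q\<^esub> q'"
    if "p \<in> carrier P" "q \<in> carrier Q" "p' \<in> carrier P" "q' \<in> carrier Q" for p q p' q'
    using PQ(5) that unfolding order_isomorphism_def order_emb_def int by (simp add: product_order_def)
  have bij: "bij_betw \<phi> (carrier P \<times> carrier Q) {W. refines A W ?X}"
    using PQ(5) unfolding order_isomorphism_def int by (simp add: product_order_def)
  have inj: "p = p' \<and> q = q'" if "p \<in> carrier P" "q \<in> carrier Q" "p' \<in> carrier P" "q' \<in> carrier Q"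
    "\<phi> (p, q) = \<phi> (p', q')" for p q p' q'
    using bij_betw_imp_inj_on[OF bij] that unfolding inj_on_def by blast
  have surj: "\<exists>p\<in>carrier P. \<exists>q\<in>carrier Q. \<phi> (p, q) = W" if "refines A W ?X" for W
  proof -
    have "W \<in> \<phi> ` (carrier P \<times> carrier Q)" using bij_betw_imp_surj_on[OF bij] that by simp
    then show ?thesis by auto
  qed
  have ran: "refines A (\<phi> (p, q)) ?X" if "p \<in> carrier P" "q \<in> carrier Q" for p q
    using bij that unfolding bij_betw_def by auto
  have part: "partition_on A (\<phi> (p, q))" if "p \<in> carrier P" "q \<in> carrier Q" for p q
    using ran[OF that] by (simp add: refines_def)
  obtain p0 q0 where 0: "p0 \<in> carrier P" "q0 \<in> carrier Q" "\<phi> (p0, q0) = singletons A"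
    using surj[OF refines_singletons[OF X]] by blast
  obtain p1 q1 where 1: "p1 \<in> carrier P" "q1 \<in> carrier Q" "\<phi> (p1, q1) = ?X"
    using surj[OF refines_refl[OF X]] by blast
  have p_le: "p0 \<sqsubseteq>\<^bsub>P\<^esub> p" "p \<sqsubseteq>\<^bsub>P\<^esub> p1" if p: "p \<in> carrier P" for p
    using emb[OF 0(1,2) p 0(2)] refines_singletons[OF part[OF p 0(2)]] 0(3)
      emb[OF p 1(2) 1(1,2)] ran[OF p 1(2)] 1(3) by auto
  have q_le: "q0 \<sqsubseteq>\<^bsub>Q\<^esub> q" "q \<sqsubseteq>\<^bsub>Q\<^esub> q1" if q: "q \<in> carrier Q" for q
    using emb[OF 0(1,2) 0(1) q] refines_singletons[OF part[OF 0(1) q]] 0(3)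
      emb[OF 1(1) q 1(1,2)] ran[OF 1(1) q] 1(3) by auto
  let ?Z = "\<phi> (p1, q0)" and ?Z' = "\<phi> (p0, q1)"
  have pairs: "(\<exists>B\<in>?Z. {x, y} \<subseteq> B) \<or> (\<exists>B\<in>?Z'. {x, y} \<subseteq> B)"
    if xy: "x \<in> C" "y \<in> C" "x \<noteq> y" for x y
  proof -
    have sub: "{x, y} \<subseteq> A" using xy C(1) by blast
    let ?a = "one_block A {x, y}"
    have "refines A ?a ?X"
      using refines_one_block[OF sub _ X] xy by (auto simp: one_block_def)
    then obtain p q where pq: "p \<in> carrier P" "q \<in> carrier Q" "\<phi> (p, q) = ?a" using surj by blast
    \<comment> \<open>lowering the second coordinate of the atom either does nothing or leads to the bottom\<close>
    have "refines A (\<phi> (p, q0)) ?a"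
      using emb[OF pq(1) 0(2) pq(1,2)] q_le(1)[OF pq(2)] pq by simp
    then have "\<phi> (p, q0) = singletons A \<or> \<phi> (p, q0) = ?a"
      by (rule refines_pair_cases) (use sub in auto)
    then have "refines A ?a ?Z \<or> refines A ?a ?Z'"
    proof
      assume "\<phi> (p, q0) = singletons A"
      then have "p = p0" using inj[OF pq(1) 0(2) 0(1,2)] 0(3) by simp
      then show ?thesis using emb[OF pq(1,2) 0(1) 1(2)] p_le(1)[OF 0(1)] q_le(2)[OF pq(2)] pq(3) by simp
    next
      assume "\<phi> (p, q0) = ?a"
      then have "q = q0" using inj[OF pq(1) 0(2) pq(1,2)] pq(3) by simp
      then show ?thesis using emb[OF pq(1,2) 1(1) 0(2)] p_le(2)[OF pq(1)] q_le(1)[OF 0(2)] pq(3) by simp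
    qed
    then show ?thesis
      using refines_one_block[OF sub _ part[OF 1(1) 0(2)]] refines_one_block[OF sub _ part[OF 0(1) 1(2)]]
      by simp
  qed
  have "(\<exists>B\<in>?Z. C \<subseteq> B) \<or> (\<exists>B\<in>?Z'. C \<subseteq> B)"
    by (rule block_of_two_partitions[OF part[OF 1(1) 0(2)] part[OF 0(1) 1(2)] C(1) Cne pairs])
  then have "refines A ?X ?Z \<or> refines A ?X ?Z'"
    using refines_one_block[OF C(1) Cne part[OF 1(1) 0(2)]]
      refines_one_block[OF C(1) Cne part[OF 0(1) 1(2)]] by simp
  then show False
  proof
    assume "refines A ?X ?Z"
    then have "q1 \<sqsubseteq>\<^bsub>Q\<^esub> q0" using emb[OF 1(1,2) 1(1) 0(2)] 1(3) by simp
    then have "q = q0" if "q \<in> carrier Q" for q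
      using Q.le_antisym[OF _ q_le(1)[OF that] that 0(2)]
        Q.le_trans[OF q_le(2)[OF that] _ that 1(2) 0(2)] by simp
    then have "carrier Q \<subseteq> {q0}" by blast
    then show False using PQ(4) card_mono[of "{q0}" "carrier Q"] by simp
  next
    assume "refines A ?X ?Z'"
    then have "p1 \<sqsubseteq>\<^bsub>P\<^esub> p0" using emb[OF 1(1,2) 0(1) 1(2)] 1(3) by simp
    then have "p = p0" if "p \<in> carrier P" for p
      using P.le_antisym[OF _ p_le(1)[OF that] that 0(1)]
        P.le_trans[OF p_le(2)[OF that] _ that 1(1) 0(1)] by simp
    then have "carrier P \<subseteq> {p0}" by blast
    then show False using PQ(3) card_mono[of "{p0}" "carrier P"] by simp
  qed
qed

lemma one_less_card:
  assumes "finite S" "a \<in> S" "b \<in> S" "a \<noteq> b" shows "1 < card S"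
proof -
  have "card {a, b} \<le> card S" using assms by (intro card_mono) auto
  then show ?thesis using assms(4) by simp
qed

lemma finite_partitions:
  assumes "finite A" shows "finite {P. partition_on A P}"
proof (rule finite_subset)
  show "{P. partition_on A P} \<subseteq> Pow (Pow A)" by (auto simp: partition_on_def)
qed (use assms in simp)

lemma partial_order_product:
  assumes "partial_order P" "partial_order Q" shows "partial_order (product_order P Q)"
proof -
  interpret P: partial_order P by fact
  interpret Q: partial_order Q by fact
  show ?thesis
    by (rule partial_orderI)
      (auto simp: product_order_def intro: P.le_antisym Q.le_antisym P.le_trans Q.le_trans)
qed

lemma partition_on_Un:
  assumes "partition_on B p" "partition_on (A - B) q" "B \<subseteq> A"
  shows "partition_on A (p \<union> q)"
proof (rule partition_onI)
  show "\<Union>(p \<union> q) = A"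
    using partition_onD1[OF assms(1)] partition_onD1[OF assms(2)] assms(3) by blast
  show "{} \<notin> p \<union> q" using partition_onD3[OF assms(1)] partition_onD3[OF assms(2)] by blast
  fix X Y assume "X \<in> p \<union> q" "Y \<in> p \<union> q" "X \<noteq> Y"
  then show "disjnt X Y"
    using assms(1,2) unfolding partition_on_def pairwise_def disjnt_iff by blast
qed

lemma partition_on_outside:
  assumes "partition_on A X" "B \<in> X" "refines A W X"
  shows "partition_on (A - B) {b \<in> W. \<not> b \<subseteq> B}"
proof -
  have W: "partition_on A W" using assms(3) by (simp add: refines_def)
  have out: "b \<inter> B = {}" if b: "b \<in> W" "\<not> b \<subseteq> B" for b
  proof -
    obtain Y where "Y \<in> X" "b \<subseteq> Y" using assms(3) b(1) by (auto simp: refines_def)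
    then show ?thesis using block_unique[OF assms(1) _ assms(2)] b(2) by blast
  qed
  show ?thesis
  proof (rule partition_onI)
    show "\<Union>{b \<in> W. \<not> b \<subseteq> B} = A - B"
      using partition_onD1[OF W] out by blast
    show "{} \<notin> {b \<in> W. \<not> b \<subseteq> B}" by simp
    show "disjnt p q" if "p \<in> {b \<in> W. \<not> b \<subseteq> B}" "q \<in> {b \<in> W. \<not> b \<subseteq> B}" "p \<noteq> q" for p q
      using partition_onD2[OF W] that by (auto simp: pairwise_def)
  qed
qed

lemma partition_on_without_block:
  assumes "partition_on A X" "B \<in> X" shows "partition_on (A - B) (X - {B})"
proof -
  have "b = B" if b: "b \<in> X" "b \<subseteq> B" for b
  proof -
    obtain x where "x \<in> b" using partition_onD3[OF assms(1)] b(1) by fastforce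
    then show ?thesis using block_unique[OF assms(1) b(1) assms(2)] b(2) by blast
  qed
  then have "{b \<in> X. \<not> b \<subseteq> B} = X - {B}" by auto
  then show ?thesis using partition_on_outside[OF assms refines_refl[OF assms(1)]] by simp
qed

lemma refines_Un_iff:
  assumes "partition_on B p" "partition_on B p'" "partition_on (A - B) q" "partition_on (A - B) q'" "B \<subseteq> A"
  shows "refines A (p \<union> q) (p' \<union> q') \<longleftrightarrow> refines B p p' \<and> refines (A - B) q q'"
proof
  assume *: "refines A (p \<union> q) (p' \<union> q')"
  have "\<exists>Z\<in>p'. Y \<subseteq> Z" if Y: "Y \<in> p" for Y
  proof -
    obtain Z where Z: "Z \<in> p' \<union> q'" "Y \<subseteq> Z" using * Y by (auto simp: refines_def)
    have "Y \<subseteq> B" "Y \<noteq> {}" using partition_onD1[OF assms(1)] partition_onD3[OF assms(1)] Y by auto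
    then have "Z \<notin> q'" using partition_onD1[OF assms(4)] Z(2) by blast
    then show ?thesis using Z by blast
  qed
  moreover have "\<exists>Z\<in>q'. Y \<subseteq> Z" if Y: "Y \<in> q" for Y
  proof -
    obtain Z where Z: "Z \<in> p' \<union> q'" "Y \<subseteq> Z" using * Y by (auto simp: refines_def)
    have "Y \<subseteq> A - B" "Y \<noteq> {}" using partition_onD1[OF assms(3)] partition_onD3[OF assms(3)] Y by auto
    then have "Z \<notin> p'" using partition_onD1[OF assms(2)] Z(2) by blast
    then show ?thesis using Z by blast
  qed
  ultimately show "refines B p p' \<and> refines (A - B) q q'" using assms by (simp add: refines_def)
next
  assume *: "refines B p p' \<and> refines (A - B) q q'"
  then have "\<forall>Y\<in>p. \<exists>Z\<in>p'. Y \<subseteq> Z" "\<forall>Y\<in>q. \<exists>Z\<in>q'. Y \<subseteq> Z" by (simp_all add: refines_def)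
  then have "\<exists>Z\<in>p' \<union> q'. Y \<subseteq> Z" if "Y \<in> p \<union> q" for Y
    using that by (metis Un_iff)
  then show "refines A (p \<union> q) (p' \<union> q')"
    using partition_on_Un[OF assms(1,3,5)] partition_on_Un[OF assms(2,4,5)]
    by (simp add: refines_def)
qed

text \<open>Below \<open>X\<close>, the refinements of the block \<open>B\<close> and of the remaining blocks are chosen
  independently. The first factor is nontrivial because of \<open>B\<close>, and the second because of \<open>B'\<close>.\<close>

lemma decomposable_two_blocks:
  fixes X :: "'a set set"
  assumes A: "finite A" and X: "partition_on A X"
    and B: "B \<in> X" "2 \<le> card B" and B': "B' \<in> X" "2 \<le> card B'" "B \<noteq> B'"
  shows "decomposable (partition_order A) X"
proof -
  let ?R = "X - {B}"
  define P where "P = partition_order B"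
  define Q where "Q = (partition_order (A - B))\<lparr>carrier := {q. refines (A - B) q ?R}\<rparr>"
  let ?\<phi> = "\<lambda>(p, q). p \<union> q"
  have Bsub: "B \<subseteq> A" using partition_onD1[OF X] B(1) by auto
  have R: "partition_on (A - B) ?R" by (rule partition_on_without_block[OF X B(1)])
  have XR: "X = {B} \<union> ?R" using B(1) by blast
  have Bpart: "partition_on B {B}" using B(2) by (intro partition_on_space) auto
  have P_simps: "carrier P = {p. partition_on B p}" "le P = refines B" by (simp_all add: P_def)
  have Q_simps: "carrier Q = {q. refines (A - B) q ?R}" "le Q = refines (A - B)" "eq Q = (=)"
    by (simp_all add: Q_def)
  have P: "partial_order P" unfolding P_def by (rule partial_order_partition_order)
  have Q: "partial_order Q"
  proof (rule partial_orderI)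
    show "p = q" if "p \<sqsubseteq>\<^bsub>Q\<^esub> q" "q \<sqsubseteq>\<^bsub>Q\<^esub> p" for p q
      using that unfolding Q_simps by (rule refines_asym)
    show "p \<sqsubseteq>\<^bsub>Q\<^esub> p" if "p \<in> carrier Q" for p
      using that unfolding Q_simps by (auto simp: refines_def)
  qed (auto simp: Q_simps intro: refines_trans)
  have "1 < card (carrier P)"
  proof (rule one_less_card)
    show "finite (carrier P)"
      unfolding P_simps by (rule finite_partitions[OF finite_subset[OF Bsub A]])
    show "{B} \<in> carrier P" "singletons B \<in> carrier P" "{B} \<noteq> singletons B"
      using Bpart partition_on_singletons' not_singletons[of B "{B}"] B(2) by (auto simp: P_simps)
  qed
  moreover have "1 < card (carrier Q)"
  proof (rule one_less_card)
    have "carrier Q \<subseteq> {q. partition_on (A - B) q}" by (auto simp: Q_simps refines_def)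
    then show "finite (carrier Q)" by (rule finite_subset) (intro finite_partitions finite_Diff A)
    show "?R \<in> carrier Q" using refines_refl[OF R] by (simp add: Q_simps)
    show "singletons (A - B) \<in> carrier Q" using refines_singletons[OF R] by (simp add: Q_simps)
    show "?R \<noteq> singletons (A - B)" using not_singletons[of B' ?R] B' by simp
  qed
  moreover have "order_isomorphism (product_order P Q) (lower_interval (partition_order A) X) ?\<phi>"
    unfolding order_isomorphism_def order_emb_def
  proof (intro conjI)
    note int = lower_interval_partition_order[OF X]
    show "weak_partial_order (product_order P Q)"
      by (rule partial_order.axioms(1)[OF partial_order_product[OF P Q]])
    have "partial_order (lower_interval (partition_order A) X)"
    proof (rule partial_orderI, unfold int)
      show "eq (lower_interval (partition_order A) X) = (=)" by (simp add: lower_interval_def)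
      show "p = q" if "refines A p q" "refines A q p" for p q
        using that by (rule refines_asym)
      show "refines A p r" if "refines A p q" "refines A q r" for p q r
        using that by (rule refines_trans)
      show "refines A p p" if "p \<in> {p. refines A p X}" for p
        using that by (auto simp: refines_def)
    qed
    then show "weak_partial_order (lower_interval (partition_order A) X)"
      by (rule partial_order.axioms(1))
    have Q_part: "partition_on (A - B) q" if "refines (A - B) q ?R" for q
      using that by (simp add: refines_def)
    have iff: "refines A (p \<union> q) (p' \<union> q') \<longleftrightarrow> refines B p p' \<and> refines (A - B) q q'"
      if "p \<in> carrier P" "q \<in> carrier Q" "p' \<in> carrier P" "q' \<in> carrier Q" for p q p' q'
      using that Q_part Bsub by (intro refines_Un_iff) (auto simp: P_simps Q_simps)
    then show "\<forall>x\<in>carrier (product_order P Q). \<forall>y\<in>carrier (product_order P Q).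
        (?\<phi> x \<sqsubseteq>\<^bsub>lower_interval (partition_order A) X\<^esub> ?\<phi> y) = (x \<sqsubseteq>\<^bsub>product_order P Q\<^esub> y)"
      unfolding int by (auto simp: product_order_def P_simps(2) Q_simps(2))
    show "bij_betw ?\<phi> (carrier (product_order P Q)) (carrier (lower_interval (partition_order A) X))"
      unfolding int
    proof (rule bij_betwI[where g = "\<lambda>W. ({b \<in> W. b \<subseteq> B}, {b \<in> W. \<not> b \<subseteq> B})"])
      have ref: "refines A (p \<union> q) X" if p: "partition_on B p" and q: "refines (A - B) q ?R" for p q
      proof -
        have "refines B p {B}" using p Bpart partition_onD1[OF p] by (auto simp: refines_def)
        then have "refines A (p \<union> q) ({B} \<union> ?R)"
          using refines_Un_iff[OF p Bpart Q_part[OF q] R Bsub] q by simp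
        then show ?thesis using XR by simp
      qed
      then show "?\<phi> \<in> carrier (product_order P Q) \<rightarrow> {W. refines A W X}"
        by (auto simp: product_order_def P_simps Q_simps)
      show "(\<lambda>W. ({b \<in> W. b \<subseteq> B}, {b \<in> W. \<not> b \<subseteq> B})) \<in> {W. refines A W X} \<rightarrow> carrier (product_order P Q)"
      proof
        fix W assume "W \<in> {W. refines A W X}"
        then have W: "refines A W X" by simp
        have "partition_on (A - B) {b \<in> W. \<not> b \<subseteq> B}" by (rule partition_on_outside[OF X B(1) W])
        moreover have "\<exists>Y\<in>?R. b \<subseteq> Y" if "b \<in> W" "\<not> b \<subseteq> B" for b
          using W that by (auto simp: refines_def)
        ultimately have "refines (A - B) {b \<in> W. \<not> b \<subseteq> B} ?R" using R by (auto simp: refines_def)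
        then show "({b \<in> W. b \<subseteq> B}, {b \<in> W. \<not> b \<subseteq> B}) \<in> carrier (product_order P Q)"
          using refines_obtains_subset[OF W B(1)] by (simp add: product_order_def P_simps Q_simps)
      qed
      show "?\<phi> ({b \<in> W. b \<subseteq> B}, {b \<in> W. \<not> b \<subseteq> B}) = W" for W by auto
      fix x assume "x \<in> carrier (product_order P Q)"
      then obtain p q where x: "x = (p, q)" "partition_on B p" "partition_on (A - B) q"
        using Q_part by (auto simp: product_order_def P_simps Q_simps)
      have "b \<subseteq> B" if "b \<in> p" for b using partition_onD1[OF x(2)] that by blast
      moreover have "\<not> b \<subseteq> B" if "b \<in> q" for b
      proof -
        have "b \<subseteq> A - B" "b \<noteq> {}"
          using partition_onD1[OF x(3)] partition_onD3[OF x(3)] that by auto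
        then show ?thesis by blast
      qed
      ultimately show "({b \<in> ?\<phi> x. b \<subseteq> B}, {b \<in> ?\<phi> x. \<not> b \<subseteq> B}) = x" unfolding x(1) by auto
    qed
  qed
  ultimately show ?thesis unfolding decomposable_def using P Q by blast
qed

lemma irreducible_partition_order:
  assumes A: "finite A"
  shows "irreducible_elements (partition_order A) = one_block A ` {C. C \<subseteq> A \<and> 2 \<le> card C}"
proof (intro equalityI subsetI)
  fix X assume "X \<in> irreducible_elements (partition_order A)"
  then have X: "partition_on A X" "X \<noteq> singletons A" "\<not> decomposable (partition_order A) X"
    by (auto simp: irreducible_elements_def bottom_partition_order)
  have small: "\<exists>x\<in>A. Y = {x}" if Y: "Y \<in> X" "\<not> 2 \<le> card Y" for Y
  proof -
    have "Y \<subseteq> A" "Y \<noteq> {}" using partition_onD1[OF X(1)] partition_onD3[OF X(1)] Y(1) by auto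
    then have "card Y \<noteq> 0" using finite_subset[OF _ A] by simp
    then have "card Y = 1" using Y(2) by linarith
    then show ?thesis using \<open>Y \<subseteq> A\<close> by (auto simp: card_1_singleton_iff)
  qed
  have "\<exists>B\<in>X. 2 \<le> card B"
  proof (rule ccontr)
    assume "\<not> ?thesis"
    then have "refines A X (singletons A)"
      using small X(1) partition_on_singletons'[of A] by (fastforce simp: refines_def singletons_def)
    then show False using refines_asym refines_singletons[OF X(1)] X(2) by blast
  qed
  then obtain B where B: "B \<in> X" "2 \<le> card B" by blast
  then have Bsub: "B \<subseteq> A" "B \<noteq> {}" using partition_onD1[OF X(1)] by auto
  note ob = partition_on_one_block[OF Bsub]
  have "\<exists>Z\<in>one_block A B. Y \<subseteq> Z" if Y: "Y \<in> X" for Y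
  proof (cases "Y = B")
    case True
    then show ?thesis by (auto simp: one_block_def)
  next
    case False
    then have "\<not> 2 \<le> card Y" using decomposable_two_blocks[OF A X(1) B Y] X(3) by blast
    then obtain x where "x \<in> A" "Y = {x}" using small[OF Y] by blast
    then show ?thesis using partition_onD1[OF ob] by blast
  qed
  then have "refines A X (one_block A B)" using X(1) ob by (simp add: refines_def)
  moreover have "refines A (one_block A B) X" using refines_one_block[OF Bsub X(1)] B(1) by blast
  ultimately have "X = one_block A B" by (rule refines_asym)
  then show "X \<in> one_block A ` {C. C \<subseteq> A \<and> 2 \<le> card C}" using B(2) Bsub by blast
next
  fix X assume "X \<in> one_block A ` {C. C \<subseteq> A \<and> 2 \<le> card C}"
  then obtain C where C: "C \<subseteq> A" "2 \<le> card C" "X = one_block A C" by blast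
  have "C \<noteq> {}" using C(2) by auto
  moreover have "X \<noteq> singletons A" using not_singletons[of C X] C(2,3) by (simp add: one_block_def)
  ultimately show "X \<in> irreducible_elements (partition_order A)"
    using partition_on_one_block[OF C(1)] one_block_not_decomposable[OF C(1,2)] C(3)
    by (simp add: irreducible_elements_def bottom_partition_order)
qed

lemma join_disjoint_blocks:
  assumes M: "\<And>C. C \<in> M \<Longrightarrow> C \<subseteq> A \<and> C \<noteq> {}" "pairwise disjnt M"
  shows "\<Squnion>\<^bsub>partition_order A\<^esub> (one_block A ` M) = M \<union> singletons (A - \<Union>M)" (is "_ = ?J")
proof (rule partial_order.sup_eqI[OF partial_order_partition_order])
  have J: "partition_on A ?J" by (rule partition_on_blocks_singletons[OF M])
  have part: "partition_on A (one_block A C)" if "C \<in> M" for C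
    using partition_on_one_block M(1)[OF that] by blast
  have "refines A (one_block A C) ?J" if "C \<in> M" for C
    using refines_one_block[OF _ _ J, of C] M(1)[OF that] that by blast
  moreover have "refines A ?J P" if P: "partition_on A P" "\<And>C. C \<in> M \<Longrightarrow> refines A (one_block A C) P" for P
  proof -
    have "\<exists>B\<in>P. C \<subseteq> B" if "C \<in> M" for C
      using refines_one_block[of C A P] M(1)[OF that] P(1) P(2)[OF that] by blast
    then show ?thesis using refines_blocks_singletons[OF J P(1)] by blast
  qed
  ultimately show "least (partition_order A) ?J (Upper (partition_order A) (one_block A ` M))"
    using J part by (auto simp: least_def Upper_def)
qed

text \<open>A partition above both has one block containing \<open>C\<close> and one containing \<open>D\<close>; these share \<open>x\<close> and
  so coincide.\<close>

lemma join_overlapping_blocks: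
  assumes "C \<subseteq> A" "D \<subseteq> A" "x \<in> C" "x \<in> D"
  shows "\<Squnion>\<^bsub>partition_order A\<^esub> {one_block A C, one_block A D} = one_block A (C \<union> D)" (is "_ = ?J")
proof (rule partial_order.sup_eqI[OF partial_order_partition_order])
  have ne: "C \<noteq> {}" "D \<noteq> {}" "C \<union> D \<noteq> {}" "C \<union> D \<subseteq> A" using assms by auto
  have J: "partition_on A ?J" by (rule partition_on_one_block[OF ne(4,3)])
  have CD: "partition_on A (one_block A C)" "partition_on A (one_block A D)"
    using partition_on_one_block assms(1,2) ne(1,2) by blast+
  have "refines A (one_block A C) ?J" "refines A (one_block A D) ?J"
    using refines_one_block[OF assms(1) ne(1) J] refines_one_block[OF assms(2) ne(2) J]
    by (auto simp: one_block_def)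
  moreover have "refines A ?J P"
    if P: "partition_on A P" "refines A (one_block A C) P" "refines A (one_block A D) P" for P
  proof -
    obtain B where B: "B \<in> P" "C \<subseteq> B" using refines_one_block[OF assms(1) ne(1) P(1)] P(2) by blast
    obtain B' where B': "B' \<in> P" "D \<subseteq> B'" using refines_one_block[OF assms(2) ne(2) P(1)] P(3) by blast
    have "B = B'" using block_unique[OF P(1) B(1) B'(1), of x] B(2) B'(2) assms(3,4) by blast
    then show ?thesis using refines_one_block[OF ne(4,3) P(1)] B B' by blast
  qed
  ultimately show "least (partition_order A) ?J (Upper (partition_order A) {one_block A C, one_block A D})"
    using J CD by (auto simp: least_def Upper_def)
qed

text \<open>Two blocks that overlap without being nested give incomparable elements with an
  irreducible join. If the family is laminar, the blocks of incomparable elements are pairwise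
  disjoint, so their join has at least two big blocks.\<close>

lemma nested_blocks_iff:
  assumes A: "finite A" and N: "\<And>C. C \<in> N \<Longrightarrow> C \<subseteq> A \<and> 2 \<le> card C"
  shows "nested (partition_order A) (irreducible_elements (partition_order A)) (one_block A ` N)
    \<longleftrightarrow> laminar N"
proof
  assume nest: "nested (partition_order A) (irreducible_elements (partition_order A)) (one_block A ` N)"
  show "laminar N"
    unfolding laminar_def
  proof (intro ballI, rule ccontr)
    fix C D assume CD: "C \<in> N" "D \<in> N" "\<not> (C \<subseteq> D \<or> D \<subseteq> C \<or> C \<inter> D = {})"
    let ?S = "{one_block A C, one_block A D}"
    have C: "C \<subseteq> A" "2 \<le> card C" and D: "D \<subseteq> A" "2 \<le> card D" using N CD by auto
    have ne: "C \<noteq> {}" "D \<noteq> {}" using CD(3) by auto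
    have incomparable: "\<not> refines A (one_block A C) (one_block A D)" "\<not> refines A (one_block A D) (one_block A C)"
      using refines_one_block_iff[OF C(1) D(1) ne(2) C(2)] refines_one_block_iff[OF D(1) C(1) ne(1) D(2)]
        CD(3) by auto
    then have "one_block A C \<noteq> one_block A D"
      using refines_refl[OF partition_on_one_block[OF C(1) ne(1)]] by auto
    then have "card ?S = 2" by simp
    then have "\<Squnion>\<^bsub>partition_order A\<^esub> ?S \<notin> irreducible_elements (partition_order A)"
      using nest CD(1,2) incomparable unfolding nested_def by (elim conjE allE[of _ ?S]) simp
    moreover obtain x where "x \<in> C" "x \<in> D" using CD(3) by blast
    then have "\<Squnion>\<^bsub>partition_order A\<^esub> ?S = one_block A (C \<union> D)" by (rule join_overlapping_blocks[OF C(1) D(1)])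
    moreover have "2 \<le> card (C \<union> D)"
      using C D A card_mono[of "C \<union> D" C] finite_subset[of "C \<union> D" A] by auto
    ultimately show False using irreducible_partition_order[OF A] C(1) D(1) by blast
  qed
next
  assume lam: "laminar N"
  show "nested (partition_order A) (irreducible_elements (partition_order A)) (one_block A ` N)"
    unfolding nested_def
  proof (intro conjI allI impI)
    show "one_block A ` N \<subseteq> irreducible_elements (partition_order A)"
      unfolding irreducible_partition_order[OF A] using N by blast
    fix S assume S: "S \<subseteq> one_block A ` N \<and> finite S \<and> 2 \<le> card S \<and>
      (\<forall>x\<in>S. \<forall>y\<in>S. x \<noteq> y \<longrightarrow> \<not> x \<sqsubseteq>\<^bsub>partition_order A\<^esub> y \<and> \<not> y \<sqsubseteq>\<^bsub>partition_order A\<^esub> x)"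
    then obtain M where M: "M \<subseteq> N" "S = one_block A ` M" by (elim conjE subset_imageE)
    have ne: "C \<subseteq> A \<and> C \<noteq> {}" if "C \<in> M" for C using N[of C] M(1) that by auto
    have disj: "C \<inter> D = {}" if CD: "C \<in> M" "D \<in> M" "C \<noteq> D" for C D
    proof -
      have CN: "C \<subseteq> A" "2 \<le> card C" "D \<subseteq> A" "2 \<le> card D" using N M(1) CD by auto
      then have "one_block A C \<noteq> one_block A D" using inj_onD[OF inj_one_block] CD(3) by blast
      then have "\<not> refines A (one_block A C) (one_block A D)" "\<not> refines A (one_block A D) (one_block A C)"
        using S M(2) CD(1,2) by auto
      then have "\<not> C \<subseteq> D" "\<not> D \<subseteq> C"
        using refines_one_block_iff[OF CN(1,3) _ CN(2)] refines_one_block_iff[OF CN(3,1) _ CN(4)]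
          ne[OF CD(1)] ne[OF CD(2)] by auto
      then show ?thesis using lam M(1) CD(1,2) unfolding laminar_def by blast
    qed
    then have "pairwise disjnt M" by (auto simp: pairwise_def disjnt_def)
    with ne have join: "\<Squnion>\<^bsub>partition_order A\<^esub> S = M \<union> singletons (A - \<Union>M)"
      unfolding M(2) by (rule join_disjoint_blocks)
    have "\<not> card S \<le> 1" using S by simp
    then have "\<not> is_singleton S" "S \<noteq> {}" by (auto simp: is_singleton_altdef)
    then obtain C D where CD: "C \<in> M" "D \<in> M" "C \<noteq> D"
      unfolding M(2) is_singleton_def by (metis image_empty image_insert insertCI ex_in_conv subsetI subset_singletonD image_is_empty)
    show "\<Squnion>\<^bsub>partition_order A\<^esub> S \<notin> irreducible_elements (partition_order A)"
    proof
      assume "\<Squnion>\<^bsub>partition_order A\<^esub> S \<in> irreducible_elements (partition_order A)"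
      then obtain E where E: "M \<union> singletons (A - \<Union>M) = one_block A E"
        unfolding irreducible_partition_order[OF A] join by blast
      have "C \<in> one_block A E" "D \<in> one_block A E" using CD unfolding E[symmetric] by auto
      then have "C = E" "D = E" using one_block_big N M(1) CD(1,2) by blast+
      then show False using CD(3) by simp
    qed
  qed
qed

lemma reduced_nested_sets_partition_order:
  assumes A: "finite A" "A \<noteq> {}"
  shows "reduced_nested_set_complex (partition_order A) (irreducible_elements (partition_order A)) =
    {one_block A ` N | N. N \<subseteq> {C. C \<subseteq> A \<and> C \<noteq> A \<and> 2 \<le> card C} \<and> laminar N}"
proof (intro equalityI subsetI)
  fix S assume "S \<in> reduced_nested_set_complex (partition_order A) (irreducible_elements (partition_order A))"
  then have S: "nested (partition_order A) (irreducible_elements (partition_order A)) S" "one_block A A \<notin> S"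
    by (auto simp: reduced_nested_set_complex_def nested_set_complex_def top_partition_order[OF A(2)])
  then have "S \<subseteq> one_block A ` {C. C \<subseteq> A \<and> 2 \<le> card C}"
    unfolding nested_def irreducible_partition_order[OF A(1)] by blast
  then obtain N where N: "N \<subseteq> {C. C \<subseteq> A \<and> 2 \<le> card C}" "S = one_block A ` N" by (elim subset_imageE)
  have "laminar N" using nested_blocks_iff[OF A(1), of N] S(1) N by blast
  moreover have "A \<notin> N" using S(2) N(2) by blast
  ultimately show "S \<in> {one_block A ` N | N. N \<subseteq> {C. C \<subseteq> A \<and> C \<noteq> A \<and> 2 \<le> card C} \<and> laminar N}"
    using N by blast
next
  fix S assume "S \<in> {one_block A ` N | N. N \<subseteq> {C. C \<subseteq> A \<and> C \<noteq> A \<and> 2 \<le> card C} \<and> laminar N}"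
  then obtain N where N: "S = one_block A ` N" "N \<subseteq> {C. C \<subseteq> A \<and> C \<noteq> A \<and> 2 \<le> card C}" "laminar N" by blast
  have "nested (partition_order A) (irreducible_elements (partition_order A)) S"
    using nested_blocks_iff[OF A(1), of N] N by blast
  moreover have "one_block A A \<notin> S"
  proof
    assume "one_block A A \<in> S"
    then obtain C where C: "C \<in> N" "one_block A A = one_block A C" unfolding N(1) by blast
    then have "C \<in> one_block A A" "C \<noteq> A" "2 \<le> card C" using N(2) by (auto simp: one_block_def)
    then show False using one_block_big by blast
  qed
  ultimately show "S \<in> reduced_nested_set_complex (partition_order A) (irreducible_elements (partition_order A))"
    by (simp add: reduced_nested_set_complex_def nested_set_complex_def top_partition_order[OF A(2)])
qed

section \<open>The isomorphism\<close>

lemma abstract_simplicial_complex_image: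
  assumes "abstract_simplicial_complex K"
  shows "abstract_simplicial_complex ((`) f ` K)"
  unfolding abstract_simplicial_complex_def
proof (intro conjI ballI allI impI)
  show "{} \<in> (`) f ` K" using assms unfolding abstract_simplicial_complex_def by force
  fix \<sigma> assume "\<sigma> \<in> (`) f ` K"
  then obtain N where N: "N \<in> K" "\<sigma> = f ` N" by blast
  then show "finite \<sigma>" using assms by (simp add: abstract_simplicial_complex_def)
  fix \<tau> assume "\<tau> \<subseteq> \<sigma>"
  then obtain M where "M \<subseteq> N" "\<tau> = f ` M" unfolding N(2) by (elim subset_imageE)
  then show "\<tau> \<in> (`) f ` K" using assms N(1) unfolding abstract_simplicial_complex_def by blast
qed

lemma image_complex_mem_iff:
  assumes "inj_on f (\<Union>K)" "M \<subseteq> \<Union>K"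
  shows "f ` M \<in> (`) f ` K \<longleftrightarrow> M \<in> K"
proof
  assume "f ` M \<in> (`) f ` K"
  then obtain N where N: "N \<in> K" "f ` M = f ` N" by blast
  then have "M = N" using inj_on_image_eq_iff[OF assms(1,2), of N] by blast
  then show "M \<in> K" using N(1) by simp
qed simp

text \<open>The isomorphism of vertices goes back along \<open>f\<close> and on along \<open>g\<close>.\<close>

lemma isomorphic_complexes_images:
  assumes K: "abstract_simplicial_complex K" and f: "inj_on f (\<Union>K)" and g: "inj_on g (\<Union>K)"
  shows "isomorphic_complexes ((`) f ` K) ((`) g ` K)"
  unfolding isomorphic_complexes_def
proof (intro conjI abstract_simplicial_complex_image[OF K] exI[of _ "g \<circ> inv_into (\<Union>K) f"] allI impI)
  let ?h = "g \<circ> inv_into (\<Union>K) f"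
  have U: "\<Union>((`) f ` K) = f ` \<Union>K" "\<Union>((`) g ` K) = g ` \<Union>K" by auto
  have "bij_betw (inv_into (\<Union>K) f) (f ` \<Union>K) (\<Union>K)"
    by (rule bij_betw_inv_into[OF inj_on_imp_bij_betw[OF f]])
  then show "bij_betw ?h (\<Union>((`) f ` K)) (\<Union>((`) g ` K))"
    unfolding U by (rule bij_betw_trans[OF _ inj_on_imp_bij_betw[OF g]])
  fix \<sigma> assume "\<sigma> \<subseteq> \<Union>((`) f ` K)"
  then obtain M where M: "M \<subseteq> \<Union>K" "\<sigma> = f ` M" unfolding U by (elim subset_imageE)
  have "?h ` \<sigma> = g ` M"
    unfolding M(2) image_comp[symmetric] using M(1) by (simp add: inv_into_image_cancel[OF f])
  then show "\<sigma> \<in> (`) f ` K \<longleftrightarrow> ?h ` \<sigma> \<in> (`) g ` K"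
    using image_complex_mem_iff[OF f M(1)] image_complex_mem_iff[OF g M(1)] M(2) by simp
qed

definition laminar_complex :: "nat \<Rightarrow> nat set set set" where
  "laminar_complex n = {N. N \<subseteq> proper_clusters n \<and> laminar N}"

lemma laminar_complex_simplicial: "abstract_simplicial_complex (laminar_complex n)"
proof -
  have "proper_clusters n \<subseteq> Pow {1..n}" by (auto simp: proper_clusters_def)
  then have "finite (proper_clusters n)" by (rule finite_subset) simp
  then have "finite N" if "N \<subseteq> proper_clusters n" for N by (rule finite_subset[OF that])
  moreover have "laminar {}" by (simp add: laminar_def)
  ultimately show ?thesis
    unfolding abstract_simplicial_complex_def laminar_complex_def
    by (auto intro: laminar_subset)
qed

theorem theorem3p1:
  fixes n :: nat
  assumes "3 \<le> n"
  shows "isomorphic_complexes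
           (complex_of_trees n)
           (reduced_nested_set_complex (partition_lattice n)
              (irreducible_elements (partition_lattice n)))"
proof -
  have lattice: "partition_lattice n = partition_order {1..n}"
    by (simp add: partition_lattice_def partition_order_def)
  have ne: "{1..n} \<noteq> {}" using assms by auto
  have "{C. C \<subseteq> {1..n} \<and> C \<noteq> {1..n} \<and> 2 \<le> card C} = proper_clusters n"
    by (simp add: proper_clusters_def)
  then have nested: "reduced_nested_set_complex (partition_lattice n)
      (irreducible_elements (partition_lattice n)) = (`) (one_block {1..n}) ` laminar_complex n"
    unfolding lattice reduced_nested_sets_partition_order[OF finite_atLeastAtMost ne]
    by (auto simp: laminar_complex_def)
  have trees: "complex_of_trees n = (`) (cluster_type n) ` laminar_complex n"
    unfolding complex_of_trees_eq[OF assms] by (auto simp: laminar_complex_def)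
  have sub: "\<Union>(laminar_complex n) \<subseteq> proper_clusters n" by (auto simp: laminar_complex_def)
  have "inj_on (cluster_type n) (\<Union>(laminar_complex n))"
    using assms by (intro inj_on_subset[OF inj_cluster_type sub]) simp
  moreover have "inj_on (one_block {1..n}) (\<Union>(laminar_complex n))"
  proof (rule inj_on_subset[OF inj_one_block])
    show "\<Union>(laminar_complex n) \<subseteq> {C. C \<subseteq> {1..n} \<and> 2 \<le> card C}"
      using sub by (auto simp: proper_clusters_def)
  qed
  ultimately show ?thesis
    unfolding trees nested by (rule isomorphic_complexes_images[OF laminar_complex_simplicial])
qed

end
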